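(* Let $\mathcal{A}$ and $\mathcal{B}$ be unital $C^*$-algebras with finite dimensional bounded trace space. If $\mathcal{A}$ and $\mathcal{B}$ are Morita equivalent, then $\mathrm{F}(\mathcal{A})$ is weightedly isomorphic to $\mathrm{F}(\mathcal{B})$ and $\mathrm{F}_{\mathrm{det}}(\mathcal{A})=\mathrm{F}_{\mathrm{det}}(\mathcal{B})$.
   Context: For a unital $C^*$-algebra $\mathcal{A}$, $\mathrm{T}(\mathcal{A})$ denotes the space of bounded traces on $\mathcal{A}$ (bounded linear functionals $\varphi$ with $\varphi(ab)=\varphi(ba)$), $\mathrm{T}(\mathcal{A})^+_1$ the set of positive traces of norm one, and $\partial_e\mathrm{T}(\mathcal{A})^+_1$ its set of extreme points. If $\mathrm{T}(\mathcal{A})$ is finite dimensional of dimension $n\ge 1$, then $\partial_e\mathrm{T}(\mathcal{A})^+_1=\{\varphi_1,\dots,\varphi_n\}$ is a basis of $\mathrm{T}(\mathcal{A})$. A self-similar pair $(p,\Phi)$ of $\mathcal{A}$ consists of a projection $p\in M_k(\mathcal{A})$, for some $k$, such that the linear span of $\{a^*pb : a,b\in\mathcal{A}^k\}$ is dense in $\mathcal{A}$ (elements of $\mathcal{A}^k$ regarded as columns), and a $*$-isomorphism $\Phi:\mathcal{A}\to pM_k(\mathcal{A})p$. It defines a linear map $T_{(p,\Phi)}$ on $\mathrm{T}(\mathcal{A})$ by $T_{(p,\Phi)}(\varphi)=(\mathrm{Tr}_k\otimes\varphi)\circ\Phi$, with $\mathrm{Tr}_k$ the unnormalized trace on $M_k(\mathbb{C})$.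 The fundamental group $\mathrm{F}(\mathcal{A})\subset GL_n(\mathbb{R})$ is the set of matrices of all the maps $T_{(p,\Phi)}$ with respect to the basis $\varphi_1,\dots,\varphi_n$ (a map $T$ has matrix $B$ if $T\varphi_j=\sum_i B_{ij}\varphi_i$); it is defined up to the indexing of the basis. The determinant fundamental group is $\mathrm{F}_{\mathrm{det}}(\mathcal{A})=\{|\det B| : B\in\mathrm{F}(\mathcal{A})\}$. For $\sigma\in S_n$, $U(\sigma)\in M_n(\mathbb{C})$ is given by $U(\sigma)_{ij}=1$ if $j=\sigma(i)$ and $U(\sigma)_{ij}=0$ otherwise. For $\mathcal{A},\mathcal{B}$ unital with $\dim\mathrm{T}(\mathcal{A})=\dim\mathrm{T}(\mathcal{B})=n$, $\mathrm{F}(\mathcal{A})$ is weightedly isomorphic to $\mathrm{F}(\mathcal{B})$ if there exist an invertible positive diagonal matrix $D\in M_n(\mathbb{C})$ and $\sigma\in S_n$ such that $\mathrm{F}(\mathcal{B})=(DU(\sigma))^{-1}\mathrm{F}(\mathcal{A})(DU(\sigma))$. (Being weightedly isomorphic includes the assertion $\dim\mathrm{T}(\mathcal{A})=\dim\mathrm{T}(\mathcal{B})$.) $\mathcal{A}$ and $\mathcal{B}$ are Morita equivalent if there exists an $\mathcal{A}$-$\mathcal{B}$ imprimitivity bimodule. *)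

theory Defs
  imports
    "HOL-Analysis.Analysis"
    "HOL-Library.Nonpos_Ints"
    "Jordan_Normal_Form.Determinant"
begin

section \<open>Complex vector spaces and unital C*-algebras\<close>

class scaleC =
  fixes scaleC :: "complex \<Rightarrow> 'a \<Rightarrow> 'a"  (infixr \<open>*\<^sub>C\<close> 75)

class complex_vector = real_vector + scaleC +
  assumes scaleC_add_right: "c *\<^sub>C (x + y) = c *\<^sub>C x + c *\<^sub>C y"
    and scaleC_add_left: "(c + d) *\<^sub>C x = c *\<^sub>C x + d *\<^sub>C x"
    and scaleC_scaleC: "c *\<^sub>C d *\<^sub>C x = (c * d) *\<^sub>C x"
    and scaleC_one: "1 *\<^sub>C x = x"
    and scaleR_scaleC: "r *\<^sub>R x = complex_of_real r *\<^sub>C x"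

class complex_normed_vector = complex_vector + real_normed_vector +
  assumes norm_scaleC: "norm (c *\<^sub>C x) = cmod c * norm x"

class star =
  fixes star :: "'a \<Rightarrow> 'a"

text \<open>The superclass \<^class>\<open>real_normed_algebra_1\<close> supplies the unit, with \<open>norm 1 = 1\<close>;
  so the zero algebra is excluded, as usual.\<close>

class cstar_algebra = complex_normed_vector + real_normed_algebra_1 + banach + star +
  assumes scaleC_mult_left: "(c *\<^sub>C a) * b = c *\<^sub>C (a * b)"
    and scaleC_mult_right: "a * (c *\<^sub>C b) = c *\<^sub>C (a * b)"
    and star_star: "star (star a) = a"
    and star_add: "star (a + b) = star a + star b"
    and star_scaleC: "star (c *\<^sub>C a) = cnj c *\<^sub>C star a"
    and star_mult: "star (a * b) = star b * star a"
    and cstar_identity: "norm (star a * a) = (norm a)\<^sup>2"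

instantiation complex :: cstar_algebra
begin

definition scaleC_complex :: "complex \<Rightarrow> complex \<Rightarrow> complex" where
  "scaleC_complex c x = c * x"

definition star_complex :: "complex \<Rightarrow> complex" where
  "star_complex = cnj"

instance
  by standard
    (simp_all add: scaleC_complex_def star_complex_def algebra_simps scaleR_conv_of_real
      norm_mult power2_eq_square)

end

global_interpretation complex_vector: Vector_Spaces.vector_space
  "scaleC :: complex \<Rightarrow> 'a \<Rightarrow> 'a::complex_vector"
  defines cspan = complex_vector.span
    and cdim = complex_vector.dim
  by standard (simp_all add: scaleC_add_right scaleC_add_left scaleC_scaleC scaleC_one)

instantiation blinfun :: (real_normed_vector, complex_normed_vector) complex_vector
begin

lift_definition scaleC_blinfun :: "complex \<Rightarrow> 'a \<Rightarrow>\<^sub>L 'b \<Rightarrow> 'a \<Rightarrow>\<^sub>L 'b"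
  is "\<lambda>c f x. c *\<^sub>C f x"
proof -
  fix c :: complex and f :: "'a \<Rightarrow> 'b"
  assume f: "bounded_linear f"
  have "bounded_linear (\<lambda>y::'b. c *\<^sub>C y)"
    by (rule bounded_linear_intro[where K = "cmod c"])
      (simp_all add: scaleC_add_right scaleR_scaleC scaleC_scaleC norm_scaleC mult.commute)
  from bounded_linear_compose[OF this f] show "bounded_linear (\<lambda>x. c *\<^sub>C f x)" .
qed

instance
  by standard
    (transfer, simp add: scaleC_add_right scaleC_add_left scaleC_scaleC scaleC_one scaleR_scaleC)+

end

definition cpositive :: "'a::cstar_algebra \<Rightarrow> bool" where
  "cpositive a \<longleftrightarrow> (\<exists>b. a = star b * b)"


section \<open>Bounded traces\<close>

text \<open>The norm of \<^typ>\<open>'a \<Rightarrow>\<^sub>L complex\<close> is the operator norm; its elements are only real-linear,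
  hence the homogeneity condition below.\<close>

definition traces :: "('a::cstar_algebra \<Rightarrow>\<^sub>L complex) set" where
  "traces = {\<phi>. (\<forall>c a. blinfun_apply \<phi> (c *\<^sub>C a) = c * blinfun_apply \<phi> a) \<and>
                (\<forall>a b. blinfun_apply \<phi> (a * b) = blinfun_apply \<phi> (b * a))}"

definition positive_traces1 :: "('a::cstar_algebra \<Rightarrow>\<^sub>L complex) set" where
  "positive_traces1 = {\<phi> \<in> traces. (\<forall>a. cpositive a \<longrightarrow> blinfun_apply \<phi> a \<in> \<real>\<^sub>\<ge>\<^sub>0) \<and> norm \<phi> = 1}"

definition extreme_traces :: "('a::cstar_algebra \<Rightarrow>\<^sub>L complex) set" where
  "extreme_traces = {\<phi>. \<phi> extreme_point_of positive_traces1}"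

definition finite_dim_traces :: "'a::cstar_algebra itself \<Rightarrow> bool" where
  "finite_dim_traces _ \<longleftrightarrow>
     (\<exists>S. finite S \<and> (traces :: ('a \<Rightarrow>\<^sub>L complex) set) = cspan S)"

definition trace_dim :: "'a::cstar_algebra itself \<Rightarrow> nat" where
  "trace_dim _ = cdim (traces :: ('a \<Rightarrow>\<^sub>L complex) set)"

definition trace_indexing :: "(nat \<Rightarrow> ('a::cstar_algebra \<Rightarrow>\<^sub>L complex)) \<Rightarrow> bool" where
  "trace_indexing \<phi> \<longleftrightarrow> bij_betw \<phi> {..<trace_dim TYPE('a)} extreme_traces"


section \<open>Self-similar pairs and the fundamental group\<close>

definition mat_star :: "'a::star mat \<Rightarrow> 'a mat" where
  "mat_star M = map_mat star (transpose_mat M)"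

definition projection_mat :: "nat \<Rightarrow> 'a::cstar_algebra mat \<Rightarrow> bool" where
  "projection_mat k p \<longleftrightarrow> p \<in> carrier_mat k k \<and> p * p = p \<and> mat_star p = p"

definition corner :: "nat \<Rightarrow> 'a::cstar_algebra mat \<Rightarrow> 'a mat set" where
  "corner k p = {p * M * p | M. M \<in> carrier_mat k k}"

definition star_iso_corner ::
  "nat \<Rightarrow> 'a::cstar_algebra mat \<Rightarrow> ('a \<Rightarrow> 'a mat) \<Rightarrow> bool" where
  "star_iso_corner k p \<Phi> \<longleftrightarrow>
     bij_betw \<Phi> UNIV (corner k p) \<and>
     (\<forall>a b. \<Phi> (a + b) = \<Phi> a + \<Phi> b) \<and>
     (\<forall>c a. \<Phi> (c *\<^sub>C a) = map_mat (scaleC c) (\<Phi> a)) \<and>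
     (\<forall>a b. \<Phi> (a * b) = \<Phi> a * \<Phi> b) \<and>
     (\<forall>a. \<Phi> (star a) = mat_star (\<Phi> a))"

definition self_similar_pair ::
  "nat \<Rightarrow> 'a::cstar_algebra mat \<Rightarrow> ('a \<Rightarrow> 'a mat) \<Rightarrow> bool" where
  "self_similar_pair k p \<Phi> \<longleftrightarrow>
     projection_mat k p \<and>
     closure (cspan {scalar_prod (map_vec star a) (p *\<^sub>v b) | a b.
       a \<in> carrier_vec k \<and> b \<in> carrier_vec k}) = UNIV \<and>
     star_iso_corner k p \<Phi>"

definition induced_map ::
  "nat \<Rightarrow> ('a::cstar_algebra \<Rightarrow> 'a mat) \<Rightarrow> ('a \<Rightarrow>\<^sub>L complex) \<Rightarrow> ('a \<Rightarrow> complex)" where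
  "induced_map k \<Phi> \<phi> = (\<lambda>a. \<Sum>i<k. blinfun_apply \<phi> (\<Phi> a $$ (i, i)))"

definition fundamental_group ::
  "(nat \<Rightarrow> ('a::cstar_algebra \<Rightarrow>\<^sub>L complex)) \<Rightarrow> real mat set" where
  "fundamental_group \<phi> =
     {B \<in> carrier_mat (trace_dim TYPE('a)) (trace_dim TYPE('a)).
        \<exists>k p \<Phi>. self_similar_pair k p \<Phi> \<and>
          (\<forall>j<trace_dim TYPE('a). induced_map k \<Phi> (\<phi> j) =
             (\<lambda>a. \<Sum>i<trace_dim TYPE('a).
                complex_of_real (B $$ (i, j)) * blinfun_apply (\<phi> i) a))}"

text \<open>The determinant does not depend on the indexing, so all indexings contribute the same set.\<close>

definition det_fundamental_group :: "'a::cstar_algebra itself \<Rightarrow> real set" where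
  "det_fundamental_group _ =
     {\<bar>Determinant.det B\<bar> | B \<phi>.
        trace_indexing (\<phi> :: nat \<Rightarrow> ('a \<Rightarrow>\<^sub>L complex)) \<and> B \<in> fundamental_group \<phi>}"

definition perm_matrix :: "nat \<Rightarrow> (nat \<Rightarrow> nat) \<Rightarrow> real mat" where
  "perm_matrix n \<sigma> = mat n n (\<lambda>(i, j). if j = \<sigma> i then 1 else 0)"

text \<open>Since the fundamental group is only defined up to the indexing of the extreme traces, the
  relation is required for all indexings; \<open>W'\<close> is the inverse of \<open>D * perm_matrix n \<sigma>\<close>.\<close>

definition weightedly_isomorphic ::
  "'a::cstar_algebra itself \<Rightarrow> 'b::cstar_algebra itself \<Rightarrow> bool" where
  "weightedly_isomorphic _ _ \<longleftrightarrow>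
     trace_dim TYPE('a) = trace_dim TYPE('b) \<and>
     (let n = trace_dim TYPE('a) in
      \<forall>(\<phi> :: nat \<Rightarrow> ('a \<Rightarrow>\<^sub>L complex)) (\<psi> :: nat \<Rightarrow> ('b \<Rightarrow>\<^sub>L complex)).
        trace_indexing \<phi> \<longrightarrow> trace_indexing \<psi> \<longrightarrow>
        (\<exists>D \<sigma> W'.
           D \<in> carrier_mat n n \<and> diagonal_mat D \<and> (\<forall>i<n. 0 < D $$ (i, i)) \<and>
           \<sigma> permutes {..<n} \<and>
           W' \<in> carrier_mat n n \<and>
           inverts_mat W' (D * perm_matrix n \<sigma>) \<and> inverts_mat (D * perm_matrix n \<sigma>) W' \<and>
           fundamental_group \<psi> = (\<lambda>M. W' * M * (D * perm_matrix n \<sigma>)) ` fundamental_group \<phi>))"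


section \<open>Morita equivalence\<close>

definition complete_wrt :: "('x::ab_group_add \<Rightarrow> real) \<Rightarrow> bool" where
  "complete_wrt N \<longleftrightarrow>
     (\<forall>s :: nat \<Rightarrow> 'x. (\<forall>e>0. \<exists>m. \<forall>i\<ge>m. \<forall>j\<ge>m. N (s i - s j) < e) \<longrightarrow>
       (\<exists>l. (\<lambda>i. N (s i - l)) \<longlonglongrightarrow> 0))"

text \<open>Unitality of the action and conjugate-linearity of the inner product in the other variable
  follow from the axioms.\<close>

locale full_left_hilbert_module =
  fixes act :: "'a::cstar_algebra \<Rightarrow> 'x::complex_vector \<Rightarrow> 'x"
    and inner :: "'x \<Rightarrow> 'x \<Rightarrow> 'a"
  assumes act_add_right: "act a (x + y) = act a x + act a y"
    and act_add_left: "act (a + b) x = act a x + act b x"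
    and act_mult: "act (a * b) x = act a (act b x)"
    and act_scaleC_left: "act (c *\<^sub>C a) x = c *\<^sub>C act a x"
    and act_scaleC_right: "act a (c *\<^sub>C x) = c *\<^sub>C act a x"
    and inner_add_left: "inner (x + y) z = inner x z + inner y z"
    and inner_scaleC_left: "inner (c *\<^sub>C x) y = c *\<^sub>C inner x y"
    and inner_act_left: "inner (act a x) y = a * inner x y"
    and star_inner: "star (inner x y) = inner y x"
    and inner_positive: "cpositive (inner x x)"
    and inner_definite: "inner x x = 0 \<Longrightarrow> x = 0"
    and inner_complete: "complete_wrt (\<lambda>x. sqrt (norm (inner x x)))"
    and inner_full: "closure (cspan {inner x y | x y. True}) = UNIV"

locale full_right_hilbert_module =
  fixes act :: "'x::complex_vector \<Rightarrow> 'b::cstar_algebra \<Rightarrow> 'x"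
    and inner :: "'x \<Rightarrow> 'x \<Rightarrow> 'b"
  assumes act_add_left: "act (x + y) a = act x a + act y a"
    and act_add_right: "act x (a + b) = act x a + act x b"
    and act_mult: "act x (a * b) = act (act x a) b"
    and act_scaleC_right: "act x (c *\<^sub>C a) = c *\<^sub>C act x a"
    and act_scaleC_left: "act (c *\<^sub>C x) a = c *\<^sub>C act x a"
    and inner_add_right: "inner x (y + z) = inner x y + inner x z"
    and inner_scaleC_right: "inner x (c *\<^sub>C y) = c *\<^sub>C inner x y"
    and inner_act_right: "inner x (act y a) = inner x y * a"
    and star_inner: "star (inner x y) = inner y x"
    and inner_positive: "cpositive (inner x x)"
    and inner_definite: "inner x x = 0 \<Longrightarrow> x = 0"
    and inner_complete: "complete_wrt (\<lambda>x. sqrt (norm (inner x x)))"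
    and inner_full: "closure (cspan {inner x y | x y. True}) = UNIV"

locale imprimitivity_bimodule =
  left: full_left_hilbert_module lact linner + right: full_right_hilbert_module ract rinner
  for lact :: "'a::cstar_algebra \<Rightarrow> 'x::complex_vector \<Rightarrow> 'x"
    and ract :: "'x \<Rightarrow> 'b::cstar_algebra \<Rightarrow> 'x"
    and linner :: "'x \<Rightarrow> 'x \<Rightarrow> 'a"
    and rinner :: "'x \<Rightarrow> 'x \<Rightarrow> 'b" +
  assumes act_commute: "ract (lact a x) b = lact a (ract x b)"
    and rinner_lact: "rinner (lact a x) y = rinner x (lact (star a) y)"
    and linner_ract: "linner (ract x b) y = linner x (ract y (star b))"
    and linner_rinner: "lact (linner x y) z = ract x (rinner y z)"

text \<open>HOL cannot quantify existentially over types, so the type underlying the bimodule is a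
  parameter; in a hypothesis with \<open>'x\<close> free this amounts to the existence of some bimodule.\<close>

definition morita_equivalent_via ::
  "'x::complex_vector itself \<Rightarrow> 'a::cstar_algebra itself \<Rightarrow> 'b::cstar_algebra itself \<Rightarrow> bool" where
  "morita_equivalent_via _ _ _ \<longleftrightarrow>
     (\<exists>(lact :: 'a \<Rightarrow> 'x \<Rightarrow> 'x) (ract :: 'x \<Rightarrow> 'b \<Rightarrow> 'x) (linner :: 'x \<Rightarrow> 'x \<Rightarrow> 'a)
        (rinner :: 'x \<Rightarrow> 'x \<Rightarrow> 'b). imprimitivity_bimodule lact ract linner rinner)"

end

theory Submission
  imports Defs
begin

text \<open>Let \<open>X\<close> be the bimodule.  Both inner products admit finite Parseval frames
  \<open>1 = \<Sum>\<^sub>i \<langle>z\<^sub>i, z\<^sub>i\<rangle>\<close>: a dense ideal contains the unit, polarization turns a representation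
  of 1 by inner products into a positive invertible \<open>\<Sum>\<^sub>i \<langle>u\<^sub>i, u\<^sub>i\<rangle>\<close>, and one rescales by its inverse
  square root.  A frame embeds \<open>A\<close> onto a full corner of a matrix algebra over \<open>B\<close> by
  \<open>a \<mapsto> (\<langle>z\<^sub>i, a z\<^sub>j\<rangle>)\<close>, and vice versa; conjugating a self-similar pair of \<open>A\<close> by these two
  embeddings gives a self-similar pair of \<open>B\<close>.  On traces, \<open>\<langle>x, y\<rangle>\<^sub>A \<mapsto> \<langle>y, x\<rangle>\<^sub>B\<close> induces a linear
  order isomorphism, which maps extreme points of the normalized positive traces to positive multiples
  of extreme points, so its matrix is monomial with positive entries, and it conjugates the
  fundamental groups.\<close>

text \<open>Pulling back traces is contravariant: the pair built for \<open>B\<close> along B ->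
  M(A) -> M(A) -> M(B) induces \<open>dual_transfer\<close> after T_\<Phi> after
  \<open>transfer\<close>. For this to be a conjugation the two transfers must be mutually inverse.
  No comparison of the two frames is needed to see this: on \<open>linner x y\<close> the transfer
  of a trace has a value in which the frame no longer occurs (\<open>transfer_linner\<close>).

  The transfer does not preserve norms. But the norm of a positive functional is its value at 1, so
  norm one is an affine condition, and rescaling after a positive linear isomorphism preserves open
  segments. The scaling factors become the diagonal matrix.

  The order theory underneath has to come first: that \<open>a\<close> is some
  \<open>star b * b\<close> reveals neither closure under sums nor square roots. The norm inequality
  in \<open>spectrally_positive\<close> gives both; the hard step is that every
  \<open>star b * b\<close> satisfies it. The same theory bounds the maps sending \<open>a\<close>
  to \<open>rinner x (lact a x)\<close>, as is required for a transferred trace to be a bounded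
  functional.\<close>

unbundle no inner_syntax and no vec_syntax

section \<open>Positivity in C*-algebras\<close>

lemma star_zero [simp]: "star (0::'a::cstar_algebra) = 0"
  using star_add[of "0::'a" 0] by simp

lemma star_minus [simp]: "star (- a) = - star (a::'a::cstar_algebra)"
  using star_add[of a "-a"] by (simp add: eq_neg_iff_add_eq_0 add.commute)

lemma star_diff: "star (a - b) = star a - star (b::'a::cstar_algebra)"
  using star_add[of a "-b"] by simp

lemma star_one [simp]: "star (1::'a::cstar_algebra) = 1"
  by (metis mult.left_neutral mult.right_neutral star_mult star_star)

lemma star_scaleR: "star (r *\<^sub>R a) = r *\<^sub>R star (a::'a::cstar_algebra)"
  by (simp add: scaleR_scaleC star_scaleC)

lemma star_sum: "star (sum f I) = (\<Sum>i\<in>I. star (f i :: 'a::cstar_algebra))"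
  by (induction I rule: infinite_finite_induct) (simp_all add: star_add)

lemma norm_star [simp]: "norm (star a) = norm (a::'a::cstar_algebra)"
proof -
  have le: "norm b \<le> norm (star b)" for b :: 'a
  proof (cases "b = 0")
    case False
    have "norm b * norm b \<le> norm (star b) * norm b"
      using cstar_identity[of b] norm_mult_ineq[of "star b" b] by (simp add: power2_eq_square)
    then show ?thesis using False by simp
  qed simp
  show ?thesis using le[of a] le[of "star a"] by (simp add: star_star)
qed

lemma star_power: "star (a ^ n) = star (a::'a::cstar_algebra) ^ n"
  by (induction n) (simp_all add: star_mult power_commutes)

lemma bounded_linear_star: "bounded_linear (star :: 'a::cstar_algebra \<Rightarrow> 'a)"
  by (rule bounded_linear_intro[where K = 1]) (simp_all add: star_add star_scaleR)

text \<open>The C*-identity iterated by repeated squaring; it stands in for the equality of norm and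
  spectral radius.\<close>

lemma norm_selfadjoint_power:
  fixes a :: "'a::cstar_algebra"
  assumes "star a = a"
  shows "norm (a ^ 2 ^ n) = norm a ^ 2 ^ n"
proof (induction n)
  case (Suc n)
  have "norm (a ^ 2 ^ Suc n) = norm (star (a ^ 2 ^ n) * a ^ 2 ^ n)"
    by (simp add: star_power assms power_add mult_2)
  also have "\<dots> = norm a ^ 2 ^ Suc n"
    unfolding cstar_identity by (simp add: Suc power_mult [symmetric] mult.commute)
  finally show ?case .
qed simp

lemma norm_selfadjoint_square:
  fixes a :: "'a::cstar_algebra"
  assumes "star a = a"
  shows "norm (a * a) = (norm a)\<^sup>2"
  using cstar_identity[of a] assms by simp

lemma selfadjoint_square_eq_0:
  fixes a :: "'a::cstar_algebra"
  assumes "star a = a" "a * a = 0"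
  shows "a = 0"
  using norm_selfadjoint_square[OF assms(1)] assms(2) by simp

section \<open>Neumann series and square roots\<close>

lemma Neumann_inverse:
  fixes x :: "'a::{real_normed_algebra_1,banach}"
  assumes "norm (1 - x) < 1"
  obtains y where "x * y = 1" "y * x = 1"
proof -
  define u where "u = 1 - x"
  have s: "summable (\<lambda>n. norm (u ^ n))"
    by (rule summable_comparison_test'[OF summable_geometric[of "norm u"], of 0])
      (use assms in \<open>simp_all add: u_def norm_power_ineq\<close>)
  then have s': "summable (\<lambda>n. u ^ n)" by (rule summable_norm_cancel)
  define y where "y = (\<Sum>n. u ^ n)"
  have "y = 1 + (\<Sum>n. u ^ Suc n)"
    unfolding y_def using suminf_split_head[OF s'] by simp
  moreover have "(\<Sum>n. u ^ Suc n) = u * y"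
    unfolding y_def using suminf_mult[OF s'] by simp
  moreover have "(\<Sum>n. u ^ Suc n) = y * u"
    unfolding y_def using suminf_mult2[OF s'] by (simp add: power_commutes)
  ultimately have "x * y = 1" "y * x = 1"
    by (simp_all add: u_def algebra_simps)
  then show ?thesis by (rule that)
qed

text \<open>Taylor coefficients of \<open>sqrt (1 - x)\<close>.  The absolute values of those of positive order sum up
  to at most 1, so the series may be used up to the boundary of the unit ball.\<close>

definition sqrt_coeff :: "nat \<Rightarrow> real" where
  "sqrt_coeff n = (-1) ^ n * ((1/2) gchoose n)"

lemma sqrt_coeff_0 [simp]: "sqrt_coeff 0 = 1"
  by (simp add: sqrt_coeff_def)

text \<open>The coefficient is a rising factorial of -1/2 over a factorial, and -1/2 is the only
  negative factor.\<close>

lemma sqrt_coeff_Suc_nonpos: "sqrt_coeff (Suc n) \<le> 0"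
proof -
  have "sqrt_coeff (Suc n) = pochhammer (- (1/2)) (Suc n) / fact (Suc n)"
    unfolding sqrt_coeff_def gbinomial_pochhammer
    by (simp add: power_mult_distrib [symmetric] flip: mult.assoc power_Suc)
  also have "pochhammer (- (1/2)) (Suc n) = - (1/2) * pochhammer (1/2 :: real) n"
    by (simp add: pochhammer_rec)
  finally show ?thesis
    by (simp add: pochhammer_nonneg divide_nonpos_pos)
qed

text \<open>The partial sums of all coefficients have a closed form that is nonnegative. Since only
  the leading coefficient 1 is positive, the others cannot exceed it in total absolute
  value.\<close>

lemma sqrt_coeff_sum_le: "(\<Sum>k<n. \<bar>sqrt_coeff (Suc k)\<bar>) \<le> 1"
proof -
  have "(\<Sum>k\<le>n. sqrt_coeff k) = (-1) ^ n * ((1/2 - 1 :: real) gchoose n)"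
    unfolding sqrt_coeff_def using gbinomial_sum_lower_neg[of "1/2 :: real" n]
    by (simp add: mult.commute)
  also have "\<dots> = pochhammer (1/2) n / fact n"
    unfolding gbinomial_pochhammer
    by (simp add: power_mult_distrib [symmetric] flip: mult.assoc)
  also have "\<dots> \<ge> 0" by (simp add: pochhammer_nonneg)
  finally have "0 \<le> 1 + (\<Sum>k<n. sqrt_coeff (Suc k))"
    by (simp add: sum.atMost_shift)
  moreover have "(\<Sum>k<n. \<bar>sqrt_coeff (Suc k)\<bar>) = - (\<Sum>k<n. sqrt_coeff (Suc k))"
    unfolding sum_negf [symmetric] using sqrt_coeff_Suc_nonpos by (intro sum.cong) auto
  ultimately show ?thesis by simp
qed

text \<open>Vandermonde's identity for 1/2 + 1/2 = 1: the Cauchy square of the series is 1 -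
  x.\<close>

lemma sqrt_coeff_convolution:
  "(\<Sum>i\<le>k. sqrt_coeff i * sqrt_coeff (k - i)) = (if k = 0 then 1 else if k = 1 then -1 else 0)"
proof -
  have "(\<Sum>i\<le>k. sqrt_coeff i * sqrt_coeff (k - i))
      = (-1) ^ k * (\<Sum>i\<le>k. ((1/2) gchoose i) * ((1/2 :: real) gchoose (k - i)))"
    unfolding sqrt_coeff_def sum_distrib_left
    by (intro sum.cong) (auto simp flip: power_add)
  also have "(\<Sum>i\<le>k. ((1/2) gchoose i) * ((1/2 :: real) gchoose (k - i))) = 1 gchoose k"
    using gbinomial_Vandermonde[of "1/2 :: real" "1/2" k]
    by (simp add: atMost_atLeast0)
  also have "(1 gchoose k :: real) = of_nat (1 choose k)"
    using binomial_gbinomial[of 1 k, where 'a = real] by simp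
  finally show ?thesis by (cases k; cases "k - 1") auto
qed

text \<open>The bound on \<open>1 - s\<close> makes \<open>s\<close> itself spectrally positive,
  with t = 1. The commutation clause holds because \<open>s\<close> is a limit of polynomials in
  \<open>y\<close>; it replaces the functional calculus in later arguments with several commuting
  elements.\<close>

lemma sqrt_series:
  fixes y :: "'a::cstar_algebra"
  assumes sa: "star y = y" and le: "norm y \<le> 1"
  shows "\<exists>s. star s = s \<and> s * s = 1 - y \<and> norm (1 - s) \<le> 1 \<and> (\<forall>x. x * y = y * x \<longrightarrow> x * s = s * x)"
proof -
  define f where "f n = sqrt_coeff n *\<^sub>R y ^ n" for n
  have fle: "norm (f n) \<le> \<bar>sqrt_coeff n\<bar>" for n
  proof -
    have "norm (y ^ n) \<le> 1"
      using norm_power_ineq[of y n] power_le_one[OF norm_ge_zero le, of n] by simp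
    then show ?thesis by (simp add: f_def mult_left_le)
  qed
  have c: "summable (\<lambda>n. \<bar>sqrt_coeff (Suc n)\<bar>)"
    by (rule summableI_nonneg_bounded[where x = 1]) (use sqrt_coeff_sum_le in auto)
  then have "summable (\<lambda>n. \<bar>sqrt_coeff n\<bar>)" by (subst (asm) summable_Suc_iff)
  then have sn: "summable (\<lambda>n. norm (f n))"
    by (rule summable_comparison_test'[of _ 0]) (use fle in auto)
  then have s: "summable f" by (rule summable_norm_cancel)
  have nS: "summable (\<lambda>n. norm (f (Suc n)))" using sn by (subst summable_Suc_iff)
  define r where "r = suminf f"
  have "star r = r"
    unfolding r_def bounded_linear.suminf[OF bounded_linear_star s]
    by (simp add: f_def [abs_def] star_scaleR star_power sa)
  moreover have "r * r = 1 - y"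
  proof -
    have "(\<lambda>k. \<Sum>i\<le>k. f i * f (k - i)) sums (r * r)"
      unfolding r_def by (rule Cauchy_product_sums[OF sn sn])
    moreover have "(\<Sum>i\<le>k. f i * f (k - i))
        = (if k = 0 then 1 else if k = 1 then - y else 0)" for k
    proof -
      have "(\<Sum>i\<le>k. f i * f (k - i)) = (\<Sum>i\<le>k. (sqrt_coeff i * sqrt_coeff (k - i)) *\<^sub>R y ^ k)"
        by (intro sum.cong) (auto simp: f_def simp flip: power_add)
      then show ?thesis
        by (simp add: scaleR_sum_left [symmetric] sqrt_coeff_convolution)
    qed
    moreover have "(\<lambda>k. if k = 0 then 1 else if k = 1 then - y else 0) sums
        (\<Sum>k\<in>{0,1::nat}. if k = 0 then 1 else if k = 1 then - y else 0)"
      by (rule sums_finite) auto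
    ultimately show ?thesis using sums_unique2 by fastforce
  qed
  moreover have "norm (1 - r) \<le> 1"
  proof -
    have "r = 1 + (\<Sum>n. f (Suc n))"
      unfolding r_def using suminf_split_head[OF s] by (simp add: f_def)
    then have "norm (1 - r) \<le> (\<Sum>n. norm (f (Suc n)))"
      using summable_norm[OF nS] by simp
    also have "\<dots> \<le> (\<Sum>n. \<bar>sqrt_coeff (Suc n)\<bar>)"
      by (rule suminf_le[OF fle nS c])
    also have "\<dots> \<le> 1" by (rule suminf_le_const[OF c sqrt_coeff_sum_le])
    finally show ?thesis .
  qed
  moreover have "\<forall>x. x * y = y * x \<longrightarrow> x * r = r * x"
  proof (intro allI impI)
    fix x assume that: "x * y = y * x"
    have "x * y ^ n = y ^ n * x" for n
      by (induction n) (simp_all add: that mult.assoc, metis mult.assoc that)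
    then show "x * r = r * x"
      unfolding r_def suminf_mult[OF s, symmetric] suminf_mult2[OF s] by (simp add: f_def)
  qed
  ultimately show ?thesis by blast
qed

text \<open>The spectrum-free description of positive elements: \<open>norm (t - a) \<le> t\<close> says that the
  spectrum of the self-adjoint element \<open>a\<close> lies in \<open>[0, 2t]\<close>.\<close>

definition spectrally_positive :: "'a::cstar_algebra \<Rightarrow> bool" where
  "spectrally_positive a \<longleftrightarrow> star a = a \<and> (\<exists>t\<ge>0. norm (t *\<^sub>R 1 - a) \<le> t)"

section \<open>Spectrum-free calculus of positive elements\<close>

lemma spectrally_positiveI: "star a = a \<Longrightarrow> norm (t *\<^sub>R 1 - a) \<le> t \<Longrightarrow> spectrally_positive a"
  unfolding spectrally_positive_def using order_trans[OF norm_ge_zero] by blast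

lemma spectrally_positive_selfadjoint: "spectrally_positive a \<Longrightarrow> star a = a"
  by (simp add: spectrally_positive_def)

lemma spectrally_positive_0: "spectrally_positive 0"
  by (auto simp: spectrally_positive_def)

text \<open>The gain of the norm description: the two bounds simply add, by the triangle
  inequality.\<close>

lemma spectrally_positive_add:
  assumes "spectrally_positive a" "spectrally_positive b"
  shows "spectrally_positive (a + b)"
proof -
  obtain s t where st: "s \<ge> 0" "t \<ge> 0" "norm (s *\<^sub>R 1 - a) \<le> s" "norm (t *\<^sub>R 1 - b) \<le> t"
    using assms by (auto simp: spectrally_positive_def)
  have eq: "(s + t) *\<^sub>R 1 - (a + b) = (s *\<^sub>R 1 - a) + (t *\<^sub>R 1 - b)"
    by (simp add: algebra_simps)
  have "norm ((s + t) *\<^sub>R 1 - (a + b)) \<le> s + t"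
    unfolding eq using norm_triangle_ineq[of "s *\<^sub>R 1 - a" "t *\<^sub>R 1 - b"] st by linarith
  moreover have "star (a + b) = a + b"
    using assms by (simp add: star_add spectrally_positive_selfadjoint)
  ultimately show ?thesis by (rule spectrally_positiveI [rotated])
qed

lemma spectrally_positive_sum:
  "(\<And>i. i \<in> I \<Longrightarrow> spectrally_positive (f i)) \<Longrightarrow> spectrally_positive (sum f I)"
  by (induction I rule: infinite_finite_induct)
    (simp_all add: spectrally_positive_0 spectrally_positive_add)

text \<open>With t = M the norm to be estimated is that of \<open>a\<close>. This says that the unit
  is an order unit.\<close>

lemma spectrally_positive_norm_diff:
  assumes "star a = a" "norm a \<le> M"
  shows "spectrally_positive (M *\<^sub>R 1 - a)"
  by (rule spectrally_positiveI[where t = M]) (simp_all add: assms star_diff star_scaleR)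

lemma spectrally_positive_scaleR:
  assumes "spectrally_positive a" "c \<ge> 0"
  shows "spectrally_positive (c *\<^sub>R a)"
proof -
  obtain t where t: "t \<ge> 0" "norm (t *\<^sub>R 1 - a) \<le> t"
    using assms(1) by (auto simp: spectrally_positive_def)
  have "norm ((c * t) *\<^sub>R 1 - c *\<^sub>R a) = c * norm (t *\<^sub>R 1 - a)"
    using assms(2) by (simp flip: scaleR_scaleR scaleR_diff_right)
  also have "\<dots> \<le> c * t" using t assms(2) by (intro mult_left_mono)
  finally show ?thesis
    using assms(1) by (intro spectrally_positiveI[where t = "c * t"])
      (simp_all add: star_scaleR spectrally_positive_selfadjoint)
qed

lemma spectrally_positive_sqrt:
  assumes "spectrally_positive a"
  shows "\<exists>s. spectrally_positive s \<and> s * s = a \<and> (\<forall>x. x * a = a * x \<longrightarrow> x * s = s * x)"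
proof -
  obtain t0 where t0: "t0 \<ge> 0" "norm (t0 *\<^sub>R 1 - a) \<le> t0" and sa: "star a = a"
    using assms by (auto simp: spectrally_positive_def)
  \<comment> \<open>Enlarging the bound by 1 preserves the inequality and allows division by
    \<open>t\<close> even if \<open>t0\<close> is 0.\<close>
  define t where "t = t0 + 1"
  have "norm (t *\<^sub>R 1 - a) \<le> t"
    using norm_triangle_ineq[of "t0 *\<^sub>R 1 - a" 1] t0 by (simp add: t_def algebra_simps)
  moreover have t: "t > 0" using t0 by (simp add: t_def)
  moreover define y where "y = 1 - (1 / t) *\<^sub>R a"
  ultimately have "norm y \<le> 1"
  proof -
    have "y = (1 / t) *\<^sub>R (t *\<^sub>R 1 - a)" using t by (simp add: y_def scaleR_diff_right)
    then show ?thesis using \<open>norm (t *\<^sub>R 1 - a) \<le> t\<close> t by (simp add: divide_simps)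
  qed
  moreover have "star y = y" by (simp add: y_def star_diff star_scaleR sa)
  ultimately have "\<exists>s. star s = s \<and> s * s = 1 - y \<and> norm (1 - s) \<le> 1 \<and> (\<forall>x. x * y = y * x \<longrightarrow> x * s = s * x)"
    by (intro sqrt_series)
  then obtain s where s: "star s = s" "s * s = 1 - y" "norm (1 - s) \<le> 1"
    "\<forall>x. x * y = y * x \<longrightarrow> x * s = s * x"
    by blast
  have "spectrally_positive s"
    using s(1,3) by (intro spectrally_positiveI[where t = 1]) simp_all
  then have "spectrally_positive (sqrt t *\<^sub>R s)"
    using t by (intro spectrally_positive_scaleR) auto
  moreover have "(sqrt t *\<^sub>R s) * (sqrt t *\<^sub>R s) = a"
    using t s(2) by (simp add: y_def)
  moreover have "x * (sqrt t *\<^sub>R s) = (sqrt t *\<^sub>R s) * x" if "x * a = a * x" for x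
    using s(4)[rule_format, of x] that by (simp add: y_def algebra_simps)
  ultimately show ?thesis by blast
qed

lemma cpositive_spectrally_positive:
  assumes "spectrally_positive a"
  shows "cpositive a"
  using spectrally_positive_sqrt[OF assms] spectrally_positive_selfadjoint
  unfolding cpositive_def by metis

text \<open>For commuting \<open>a\<close> and \<open>b\<close> the cross terms cancel in
  \<open>star v * v\<close> with \<open>v = b + \<i> *\<^sub>C a\<close>, so \<open>v\<close> has
  squared norm M, and \<open>b\<close> is the real part of \<open>v\<close>.\<close>

lemma norm_square_le_sum_of_squares:
  fixes a b :: "'a::cstar_algebra"
  assumes "star a = a" "star b = b" "a * b = b * a" "a * a + b * b = M *\<^sub>R 1" "M \<ge> 0"
  shows "norm (b * b) \<le> M"
proof -
  define v where "v = b + \<i> *\<^sub>C a"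
  have "star v * v = M *\<^sub>R 1"
  proof -
    have "star v = b + (-\<i>) *\<^sub>C a" by (simp add: v_def star_add star_scaleC assms)
    then have "star v * v = b * b + \<i> *\<^sub>C (b * a) + (-\<i>) *\<^sub>C (a * b) + (-\<i> * \<i>) *\<^sub>C (a * a)"
      by (simp add: v_def distrib_left distrib_right left_diff_distrib
          complex_vector.scale_right_diff_distrib scaleC_mult_left
          scaleC_mult_right
          scaleC_scaleC scaleC_add_right)
    then show ?thesis using assms(3,4) by (simp add: scaleC_one add.commute)
  qed
  then have v: "(norm v)\<^sup>2 = M" using cstar_identity[of v] assms(5) by simp
  have "v + star v = 2 *\<^sub>R b"
    by (simp add: v_def star_add star_scaleC assms scaleR_2 add.assoc)
  then have "2 * norm b \<le> 2 * norm v"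
    using norm_triangle_ineq[of v "star v"] by simp
  then have "(norm b)\<^sup>2 \<le> (norm v)\<^sup>2" by (intro power_mono) auto
  then show ?thesis using v norm_selfadjoint_square[OF assms(2)] by simp
qed

text \<open>With M the squared norm of \<open>a\<close> and \<open>r\<close> the square root of M -
  a a, the preceding bound applied to the commuting pair \<open>a\<close>, \<open>r\<close> says
  that M - a a has norm at most M, which is the definition with t = M.\<close>

lemma spectrally_positive_square:
  assumes "star a = a"
  shows "spectrally_positive (a * a)"
proof -
  define M where "M = (norm a)\<^sup>2"
  have sa: "star (a * a) = a * a" by (simp add: star_mult assms)
  have nM: "norm (a * a) \<le> M" by (simp add: M_def norm_selfadjoint_square assms)
  obtain r where r: "spectrally_positive r" "r * r = M *\<^sub>R 1 - a * a"
    "\<forall>x. x * (M *\<^sub>R 1 - a * a) = (M *\<^sub>R 1 - a * a) * x \<longrightarrow> x * r = r * x"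
    using spectrally_positive_sqrt[OF spectrally_positive_norm_diff[OF sa nM]] by blast
  have "a * r = r * a" by (rule r(3)[rule_format]) (simp add: algebra_simps)
  then have "norm (r * r) \<le> M"
    using r(1,2) by (intro norm_square_le_sum_of_squares[of a r])
      (simp_all add: assms spectrally_positive_selfadjoint M_def)
  then show ?thesis
    using sa r(2) by (intro spectrally_positiveI[where t = M]) simp_all
qed

text \<open>For M = \<open>norm (x + y)\<close> the element M - x is a sum of positive ones.
  Commuting square roots of M - x and \<open>x\<close> have squares adding up to M, so
  \<open>norm x\<close> is at most M.\<close>

lemma spectrally_positive_norm_mono:
  assumes "spectrally_positive x" "spectrally_positive y"
  shows "norm x \<le> norm (x + y)"
proof -
  define M where "M = norm (x + y)"
  have "spectrally_positive ((M *\<^sub>R 1 - (x + y)) + y)"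
    using assms by (intro spectrally_positive_add spectrally_positive_norm_diff)
      (auto simp: M_def star_add spectrally_positive_selfadjoint)
  then have "spectrally_positive (M *\<^sub>R 1 - x)" by simp
  then obtain a where a: "spectrally_positive a" "a * a = M *\<^sub>R 1 - x"
    using spectrally_positive_sqrt by blast
  obtain b where b: "spectrally_positive b" "b * b = x" "\<forall>z. z * x = x * z \<longrightarrow> z * b = b * z"
    using spectrally_positive_sqrt[OF assms(1)] by blast
  have "a * x = x * a"
  proof -
    have x: "x = M *\<^sub>R 1 - a * a" using a by simp
    show ?thesis unfolding x by (simp add: algebra_simps)
  qed
  then have "a * b = b * a" using b(3) by blast
  then have "norm (b * b) \<le> M"
    using a b(1,2) by (intro norm_square_le_sum_of_squares[of a b])
      (auto simp: spectrally_positive_selfadjoint M_def)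
  then show ?thesis using b(2) by (simp add: M_def)
qed

lemma spectrally_positive_antisym:
  assumes "spectrally_positive x" "spectrally_positive (- x)"
  shows "x = 0"
  using spectrally_positive_norm_mono[OF assms] by simp

text \<open>Replaces the coincidence of the nonzero spectra of \<open>d\<^sup>* d\<close> and \<open>d d\<^sup>*\<close>: the \<open>n\<close>-th powers of
  \<open>t + d\<^sup>* d\<close> and \<open>t + d d\<^sup>*\<close> have norms differing by a factor linear in \<open>n\<close>, so the norms agree in
  the limit \<open>n = 2 ^ k \<longrightarrow> \<infinity>\<close>.\<close>

lemma spectrally_positive_minus_star_swap:
  fixes d :: "'a::cstar_algebra"
  assumes "spectrally_positive (- (star d * d))"
  shows "spectrally_positive (- (d * star d))"
proof -
  obtain t where t: "t \<ge> 0" "norm (t *\<^sub>R 1 + star d * d) \<le> t"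
    using assms by (auto simp: spectrally_positive_def)
  define X where "X = t *\<^sub>R 1 + star d * d"
  define Y where "Y = t *\<^sub>R 1 + d * star d"
  \<comment> \<open>The divided difference of the n-th powers of \<open>X\<close> and
    \<open>t\<close>. As \<open>X - t\<close> is \<open>star d * d\<close>, placing
    \<open>q n\<close> between \<open>d\<close> and \<open>star d\<close> yields the difference of
    the n-th powers of \<open>Y\<close> and \<open>t\<close>.\<close>
  define q where "q n = (\<Sum>j<n. t ^ (n - Suc j) *\<^sub>R X ^ j)" for n
  define N where "N = (norm d)\<^sup>2"
  have q_Suc: "q (Suc n) = t *\<^sub>R q n + X ^ n" for n
    by (simp add: q_def scaleR_sum_right Suc_diff_Suc) 
      (intro sum.cong refl, simp flip: power_Suc add: Suc_diff_Suc)
  have Yd: "Y * d = d * X"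
    by (simp add: X_def Y_def algebra_simps)
  have Yn: "Y ^ n * d = d * X ^ n" for n
  proof (induction n)
    case (Suc n)
    have "Y ^ Suc n * d = Y * (Y ^ n * d)" by (simp add: mult.assoc)
    also have "\<dots> = d * X ^ Suc n" unfolding Suc by (simp add: Yd flip: mult.assoc)
    finally show ?case .
  qed simp
  have "Y ^ n = t ^ n *\<^sub>R 1 + d * q n * star d" for n
  proof (induction n)
    case (Suc n)
    have "Y ^ Suc n = Y ^ n * Y" by (rule power_Suc2)
    also have "\<dots> = t *\<^sub>R Y ^ n + Y ^ n * d * star d"
      by (simp add: Y_def distrib_left mult.assoc)
    also have "\<dots> = t ^ Suc n *\<^sub>R 1 + d * q (Suc n) * star d"
      unfolding Yn q_Suc by (subst Suc) (simp add: algebra_simps)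
    finally show ?case .
  qed (simp add: q_def)
  moreover have "norm (q n) \<le> n * t ^ (n - 1)" for n
  proof -
    have "norm (q n) \<le> (\<Sum>j<n. norm (t ^ (n - Suc j) *\<^sub>R X ^ j))"
      unfolding q_def by (rule norm_sum)
    also have "\<dots> \<le> (\<Sum>j<n. t ^ (n - 1))"
    proof (rule sum_mono)
      fix j assume "j \<in> {..<n}"
      then have "n - 1 = (n - Suc j) + j" by auto
      moreover have "norm (X ^ j) \<le> t ^ j"
        using norm_power_ineq[of X j] power_mono[of "norm X" t j] t by (simp add: X_def)
      ultimately show "norm (t ^ (n - Suc j) *\<^sub>R X ^ j) \<le> t ^ (n - 1)"
        using t by (simp add: power_add mult_left_mono)
    qed
    finally show ?thesis by simp
  qed
  ultimately have le: "norm (Y ^ n) \<le> t ^ n + N * (n * t ^ (n - 1))" for n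
  proof -
    assume q: "\<And>n. norm (q n) \<le> real n * t ^ (n - 1)"
      and Y: "\<And>n. Y ^ n = t ^ n *\<^sub>R 1 + d * q n * star d"
    have "norm (Y ^ n) \<le> norm (t ^ n *\<^sub>R (1::'a)) + norm (d * q n * star d)"
      unfolding Y by (rule norm_triangle_ineq)
    also have "norm (d * q n * star d) \<le> norm d * norm (q n) * norm d"
      by (metis mult_right_mono norm_ge_zero norm_mult_ineq norm_star order_trans)
    also have "\<dots> \<le> N * (n * t ^ (n - 1))"
      using mult_left_mono[OF q[of n], of N] by (simp add: N_def power2_eq_square mult_ac)
    finally show ?thesis using t by simp
  qed
  have "norm Y \<le> t"
  proof (rule ccontr)
    assume "\<not> norm Y \<le> t"
    then have gt: "norm Y > t" by simp
    define y where "y = norm Y"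
    have y0: "y > 0" using gt t(1) unfolding y_def by linarith
    define \<rho> where "\<rho> = t / y"
    have \<rho>: "0 \<le> \<rho>" "\<rho> < 1" using gt t y0 by (auto simp: \<rho>_def y_def)
    \<comment> \<open>This is \<open>le\<close> at exponent 2^k, divided by the corresponding power
      of \<open>norm Y\<close>. As \<rho> < 1, the right-hand side tends to 0, which is the
      contradiction.\<close>
    have bound: "1 \<le> \<rho> ^ (2 ^ k) + N / y * (2 ^ k * \<rho> ^ (2 ^ k - 1))" for k :: nat
    proof -
      have "star Y = Y" by (simp add: Y_def star_add star_scaleR star_mult star_star)
      then have "y ^ 2 ^ k \<le> t ^ 2 ^ k + N * (2 ^ k * t ^ (2 ^ k - 1))"
        using le[of "2 ^ k"] norm_selfadjoint_power[of Y k] by (simp add: y_def)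
      then have "1 \<le> (t ^ 2 ^ k + N * (2 ^ k * t ^ (2 ^ k - 1))) / y ^ 2 ^ k"
        using y0 by (simp add: le_divide_eq)
      also have "\<dots> = \<rho> ^ (2 ^ k) + N * (2 ^ k * t ^ (2 ^ k - 1)) / (y * y ^ (2 ^ k - 1))"
        by (simp add: \<rho>_def add_divide_distrib power_divide flip: power_Suc)
      finally show ?thesis by (simp add: \<rho>_def power_divide field_simps)
    qed
    have k: "filterlim (\<lambda>k::nat. 2 ^ k :: nat) at_top at_top"
      by (rule filterlim_at_top_mono[OF filterlim_ident]) (auto intro: always_eventually less_imp_le)
    have l1: "(\<lambda>n. \<rho> ^ n) \<longlonglongrightarrow> 0" using \<rho> by (intro LIMSEQ_realpow_zero)
    have l2: "(\<lambda>n. real n * \<rho> ^ n) \<longlonglongrightarrow> 0" using powser_times_n_limit_0[of \<rho>] \<rho> by simp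
    have "(\<lambda>n. real (Suc n) * \<rho> ^ n) \<longlonglongrightarrow> 0"
      using tendsto_add[OF l1 l2] by (simp add: algebra_simps)
    then have l3: "(\<lambda>n. real n * \<rho> ^ (n - 1)) \<longlonglongrightarrow> 0"
      using LIMSEQ_imp_Suc[where f = "\<lambda>n. real n * \<rho> ^ (n - 1)" and l = 0]
      by (simp only: diff_Suc_1)
    have "(\<lambda>n. \<rho> ^ n + N / y * (real n * \<rho> ^ (n - 1))) \<longlonglongrightarrow> 0 + N / y * 0"
      by (intro tendsto_intros l1 l3)
    from filterlim_compose[OF this k]
    have "(\<lambda>k::nat. \<rho> ^ (2 ^ k) + N / y * (2 ^ k * \<rho> ^ (2 ^ k - 1))) \<longlonglongrightarrow> 0" by simp
    from LIMSEQ_le_const[OF this, of 1] show False using bound by auto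
  qed
  then show ?thesis
    by (intro spectrally_positiveI[where t = t]) (simp_all add: Y_def star_mult star_star)
qed

text \<open>In the proof \<open>p\<close> is twice the negative part of \<open>c = b\<^sup>* b\<close>, so \<open>d = b p\<close> satisfies
  \<open>d\<^sup>* d = p c p \<le> 0\<close>; then also \<open>d d\<^sup>* \<le> 0\<close>, but \<open>d\<^sup>* d + d d\<^sup>* \<ge> 0\<close>, whence \<open>d = 0\<close> and \<open>p = 0\<close>.\<close>

lemma spectrally_positive_star_mult: "spectrally_positive (star b * b)"
proof -
  define c where "c = star b * b"
  have sc: "star c = c" by (simp add: c_def star_mult star_star)
  \<comment> \<open>\<open>m\<close> is the absolute value of \<open>c\<close>.\<close>
  obtain m where m: "spectrally_positive m" "m * m = c * c"
    "\<forall>x. x * (c * c) = (c * c) * x \<longrightarrow> x * m = m * x"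
    using spectrally_positive_sqrt[OF spectrally_positive_square[OF sc]] by blast
  have cm: "c * m = m * c" by (rule m(3)[rule_format]) (simp add: mult.assoc)
  \<comment> \<open>The square root of the absolute value displays \<open>p * m * p\<close> as the
    square of the self-adjoint \<open>r * p\<close>; squares of self-adjoint elements are already
    known to be positive.\<close>
  obtain r where r: "spectrally_positive r" "r * r = m" "\<forall>x. x * m = m * x \<longrightarrow> x * r = r * x"
    using spectrally_positive_sqrt[OF m(1)] by blast
  have sm: "star m = m" and sr: "star r = r"
    using m(1) r(1) by (simp_all add: spectrally_positive_selfadjoint)
  define p where "p = m - c"
  have sp: "star p = p" by (simp add: p_def star_diff sm sc)
  have mp: "m * p = p * m" by (simp add: p_def algebra_simps cm)
  then have rp: "p * r = r * p" using r(3)[rule_format, of p] by simp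
  have cp: "c * p = - (m * p)" by (simp add: p_def algebra_simps cm m(2))
  have pcp: "p * c * p = - ((r * p) * (r * p))"
  proof -
    have "p * c * p = - (p * m * p)" by (simp add: mult.assoc cp)
    also have "p * m * p = (r * p) * (r * p)" by (simp add: mult.assoc rp flip: r(2)) (metis mult.assoc rp)
    finally show ?thesis .
  qed
  define d where "d = b * p"
  have dd: "star d * d = - ((r * p) * (r * p))"
    using pcp by (simp add: d_def star_mult sp c_def mult.assoc)
  have srp: "star (r * p) = r * p" by (simp add: star_mult sp sr rp)
  have neg: "spectrally_positive (- (star d * d))"
    using spectrally_positive_square[OF srp] by (simp add: dd)
  \<comment> \<open>Real and imaginary part of \<open>d\<close>; the sum of
    \<open>star d * d\<close> and \<open>d * star d\<close> is twice the sum of their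
    squares.\<close>
  define x where "x = (1/2) *\<^sub>R (d + star d)"
  define y where "y = (1/2) *\<^sub>C (\<i> *\<^sub>C (star d - d))"
  have "star x = x" by (simp add: x_def star_scaleR star_add star_star add.commute)
  have "star y = y" 
    by (simp add: y_def star_scaleC star_diff star_star complex_vector.scale_right_diff_distrib)
  have "star d * d + d * star d = 2 *\<^sub>R (x * x + y * y)"
  proof -
    have "y * y = (-1/4) *\<^sub>C ((star d - d) * (star d - d))"
      by (simp add: y_def scaleC_mult_left scaleC_mult_right scaleC_scaleC)
    then have "y * y = (-1/4) *\<^sub>R ((star d - d) * (star d - d))"
      by (simp add: scaleR_scaleC)
    moreover have "x * x = (1/4) *\<^sub>R ((d + star d) * (d + star d))"
      by (simp add: x_def)
    ultimately have "2 *\<^sub>R (x * x + y * y)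
        = (1/2) *\<^sub>R ((d + star d) * (d + star d) - (star d - d) * (star d - d))"
      by (simp add: scaleR_add_right scaleR_diff_right)
    also have "(d + star d) * (d + star d) - (star d - d) * (star d - d)
        = 2 *\<^sub>R (star d * d + d * star d)"
      by (simp add: algebra_simps scaleR_2)
    finally show ?thesis by simp
  qed
  moreover have "spectrally_positive (x * x + y * y)"
    using \<open>star x = x\<close> \<open>star y = y\<close> by (intro spectrally_positive_add spectrally_positive_square)
  ultimately have "spectrally_positive (star d * d + d * star d)"
    by (simp add: spectrally_positive_scaleR)
  from spectrally_positive_add[OF this neg] have "spectrally_positive (d * star d)" by simp
  with spectrally_positive_minus_star_swap[OF neg] have "d * star d = 0"
    using spectrally_positive_antisym by blast
  then have "star d = 0" using cstar_identity[of "star d"] by (simp add: star_star)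
  then have "(r * p) * (r * p) = 0" using dd by simp
  then have "r * p = 0" using selfadjoint_square_eq_0[OF srp] by blast
  then have "m * p = 0" by (simp add: mult.assoc flip: r(2))
  \<comment> \<open>As \<open>c * p = - (m * p)\<close>, the square of \<open>p = m - c\<close> is
    twice \<open>m * p\<close>.\<close>
  then have "p * p = 0" using cp by (simp add: p_def algebra_simps)
  then have "p = 0" using selfadjoint_square_eq_0[OF sp] by blast
  then show ?thesis using m(1) by (simp add: p_def c_def)
qed

lemma cpositive_iff_spectrally_positive: "cpositive a \<longleftrightarrow> spectrally_positive a"
  using cpositive_spectrally_positive spectrally_positive_star_mult cpositive_def by metis

lemma selfadjoint_decomposition:
  fixes a :: "'a::cstar_algebra"
  obtains u v where "star u = u" "star v = v" "norm u \<le> norm a" "norm v \<le> norm a"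
    "a = u + \<i> *\<^sub>C v"
proof -
  define u where "u = (1/2) *\<^sub>R (a + star a)"
  define v where "v = (1/2) *\<^sub>R (\<i> *\<^sub>C (star a - a))"
  have u: "star u = u" by (simp add: u_def star_scaleR star_add star_star add.commute)
  have v: "star v = v"
    by (simp add: v_def star_scaleR star_scaleC star_diff star_star
        complex_vector.scale_right_diff_distrib)
  have nu: "norm u \<le> norm a"
    using norm_triangle_ineq[of a "star a"] by (simp add: u_def)
  have nv: "norm v \<le> norm a"
    using norm_triangle_ineq4[of "star a" a] by (simp add: v_def norm_scaleC)
  have "\<i> *\<^sub>C v = (1/2) *\<^sub>R (a - star a)"
    by (simp add: v_def scaleR_scaleC scaleC_scaleC complex_vector.scale_right_diff_distrib)
  then have "u + \<i> *\<^sub>C v = (1/2) *\<^sub>R (2 *\<^sub>R a)"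
    unfolding u_def by (simp add: scaleR_2 flip: scaleR_add_right)
  then have "a = u + \<i> *\<^sub>C v" by simp
  with u v nu nv show ?thesis by (rule that)
qed

section \<open>Parseval frames\<close>

definition two_sided_ideal :: "'a::ring_1 set \<Rightarrow> bool" where
  "two_sided_ideal J \<longleftrightarrow> 0 \<in> J \<and> (\<forall>x\<in>J. \<forall>y\<in>J. x + y \<in> J) \<and> (\<forall>x\<in>J. \<forall>a. a * x \<in> J \<and> x * a \<in> J)"

lemma two_sided_ideal_add: "two_sided_ideal J \<Longrightarrow> x \<in> J \<Longrightarrow> y \<in> J \<Longrightarrow> x + y \<in> J"
  and two_sided_ideal_mult_left: "two_sided_ideal J \<Longrightarrow> x \<in> J \<Longrightarrow> a * x \<in> J"
  and two_sided_ideal_mult_right: "two_sided_ideal J \<Longrightarrow> x \<in> J \<Longrightarrow> x * a \<in> J"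
  by (auto simp: two_sided_ideal_def)

lemma two_sided_ideal_sum:
  assumes "two_sided_ideal J" "\<And>i. i \<in> I \<Longrightarrow> f i \<in> J"
  shows "sum f I \<in> J"
  using assms(2)
  by (induction I rule: infinite_finite_induct)
    (use assms(1) in \<open>auto simp: two_sided_ideal_def\<close>)

text \<open>A complex multiple of an element is its product with a multiple of the unit, so a ring
  ideal is a complex subspace.\<close>

lemma two_sided_ideal_cspan:
  fixes J :: "'a::cstar_algebra set"
  assumes J: "two_sided_ideal J" and "S \<subseteq> J"
  shows "cspan S \<subseteq> J"
proof (rule complex_vector.span_minimal[OF assms(2)])
  have "c *\<^sub>C x \<in> J" if "x \<in> J" for c x
    using two_sided_ideal_mult_left[OF J that, of "c *\<^sub>C 1"] by (simp add: scaleC_mult_left)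
  then show "complex_vector.subspace J"
    using J by (auto simp: complex_vector.subspace_def two_sided_ideal_def)
qed

text \<open>A dense ideal meets the open unit ball around 1, and all elements there are
  invertible.\<close>

lemma dense_two_sided_ideal:
  fixes J :: "'a::cstar_algebra set"
  assumes J: "two_sided_ideal J" and "S \<subseteq> J" "closure (cspan S) = UNIV"
  shows "1 \<in> J"
proof -
  have "1 \<in> closure J"
    using closure_mono[OF two_sided_ideal_cspan[OF assms(1,2)]] assms(3) by auto
  then have "\<exists>x\<in>J. dist x 1 < 1"
    unfolding closure_approachable by (rule allE[of _ 1]) simp
  then obtain x where x: "x \<in> J" "dist x 1 < 1" by blast
  then have "norm (1 - x) < 1" by (simp add: dist_norm norm_minus_commute)
  from Neumann_inverse[OF this] obtain y where "x * y = 1" by blast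
  then show ?thesis using two_sided_ideal_mult_right[OF J x(1), of y] by simp
qed

text \<open>Formulated for a bare abelian group with a left action so that it also serves the right
  module, on which \<open>b\<close> is made to act from the left by
  \<open>ract x (star b)\<close>.\<close>

lemma Parseval_frame:
  fixes act :: "'a::cstar_algebra \<Rightarrow> 'x::ab_group_add \<Rightarrow> 'x" and inner :: "'x \<Rightarrow> 'x \<Rightarrow> 'a"
  assumes inner_add_left: "\<And>x y z. inner (x + y) z = inner x z + inner y z"
    and inner_act_left: "\<And>a x y. inner (act a x) y = a * inner x y"
    and star_inner: "\<And>x y. star (inner x y) = inner y x"
    and inner_positive: "\<And>x. cpositive (inner x x)"
    and inner_full: "closure (cspan {inner x y | x y. True}) = UNIV"
  obtains z :: "nat \<Rightarrow> 'x" and n where "(\<Sum>i<n. inner (z i) (z i)) = 1"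
proof -
  have inner_add_right: "inner x (y + z) = inner x y + inner x z" for x y z
    by (metis star_inner inner_add_left star_add)
  have inner_act_right: "inner x (act a y) = inner x y * star a" for a x y
    by (metis star_inner inner_act_left star_mult)
  \<comment> \<open>Sums without coefficients suffice: the action absorbs every multiplier into one
    argument of the inner product.\<close>
  define J where "J = range (\<lambda>ps. \<Sum>(x, y)\<leftarrow>ps. inner x y)"
  have ideal: "two_sided_ideal J"
    unfolding two_sided_ideal_def
  proof (intro conjI ballI allI)
    show "0 \<in> J" by (auto simp: J_def intro!: image_eqI[of _ _ "[]"])
  next
    fix u v assume "u \<in> J" "v \<in> J"
    then obtain ps qs where "u = (\<Sum>(x, y)\<leftarrow>ps. inner x y)" "v = (\<Sum>(x, y)\<leftarrow>qs. inner x y)"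
      by (auto simp: J_def)
    then show "u + v \<in> J" by (auto simp: J_def intro!: image_eqI[of _ _ "ps @ qs"])
  next
    fix u a assume "u \<in> J"
    then obtain ps where u: "u = (\<Sum>(x, y)\<leftarrow>ps. inner x y)" by (auto simp: J_def)
    have "a * u = (\<Sum>(x, y)\<leftarrow>map (\<lambda>(x, y). (act a x, y)) ps. inner x y)"
      unfolding u by (induction ps) (auto simp: inner_act_left distrib_left)
    then show "a * u \<in> J" unfolding J_def by blast
    have "u * a = (\<Sum>(x, y)\<leftarrow>map (\<lambda>(x, y). (x, act (star a) y)) ps. inner x y)"
      unfolding u by (induction ps) (auto simp: inner_act_right star_star distrib_right)
    then show "u * a \<in> J" unfolding J_def by blast
  qed
  have "{inner x y | x y. True} \<subseteq> J"
  proof clarify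
    fix x y show "inner x y \<in> J" unfolding J_def by (rule image_eqI[of _ _ "[(x, y)]"]) auto
  qed
  then have "1 \<in> J" by (rule dense_two_sided_ideal[OF ideal _ inner_full])
  then obtain ps where "1 = (\<Sum>(x, y)\<leftarrow>ps. inner x y)" by (auto simp: J_def)
  then have one: "1 = (\<Sum>i<length ps. inner (fst (ps ! i)) (snd (ps ! i)))"
    by (simp add: sum_list_sum_nth atLeast0LessThan case_prod_beta)
  define n where "n = length ps"
  define x where "x i = fst (ps ! i)" for i
  define y where "y i = snd (ps ! i)" for i
  have xy: "(\<Sum>i<n. inner (x i) (y i)) = 1" using one by (simp add: n_def x_def y_def)
  have "(\<Sum>i<n. inner (y i) (x i)) = star (\<Sum>i<n. inner (x i) (y i))"
    by (simp add: star_sum star_inner)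
  then have yx: "(\<Sum>i<n. inner (y i) (x i)) = 1" by (simp add: xy)
  define h where "h = (\<Sum>i<n. inner (x i + y i) (x i + y i))"
  define g where "g = (\<Sum>i<n. inner (x i - y i) (x i - y i))"
  \<comment> \<open>Both sums of cross terms equal 1, so this identity gives
    \<open>h = 4 *\<^sub>R 1 + g\<close> with \<open>g\<close> positive: \<open>h\<close> is bounded
    below by 4.\<close>
  have pol: "inner (u + v) (u + v) = 2 *\<^sub>R inner u v + 2 *\<^sub>R inner v u + inner (u - v) (u - v)" for u v
  proof -
    have "inner (u - v) w + inner v w = inner u w" for w
      using inner_add_left[of "u - v" v w] by simp
    moreover have "inner w (u - v) + inner w v = inner w u" for w
      using inner_add_right[of w "u - v" v] by simp
    ultimately have "inner (u - v) w = inner u w - inner v w" "inner w (u - v) = inner w u - inner w v" for w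
      by (simp_all add: eq_diff_eq)
    then show ?thesis by (simp add: inner_add_left inner_add_right scaleR_2)
  qed
  have hg: "h = 4 *\<^sub>R 1 + g"
  proof -
    have "h = 2 *\<^sub>R (\<Sum>i<n. inner (x i) (y i)) + 2 *\<^sub>R (\<Sum>i<n. inner (y i) (x i)) + g"
      unfolding h_def g_def pol by (simp add: sum.distrib scaleR_sum_right)
    then show ?thesis unfolding xy yx by (simp flip: scaleR_add_left)
  qed
  have "spectrally_positive (inner u u)" for u
    using inner_positive cpositive_iff_spectrally_positive by blast
  then have gpos: "spectrally_positive g" and hpos: "spectrally_positive h"
    by (auto simp: g_def h_def intro: spectrally_positive_sum)
  obtain t where t: "t \<ge> 0" "norm (t *\<^sub>R 1 - g) \<le> t"
    using gpos by (auto simp: spectrally_positive_def)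
  \<comment> \<open>The bound \<open>t\<close> for \<open>g\<close> gives the left-hand side norm at
    most t / (t + 4) < 1, so \<open>h\<close> is invertible after scaling.\<close>
  have "1 - (1 / (t + 4)) *\<^sub>R h = (1 / (t + 4)) *\<^sub>R (t *\<^sub>R 1 - g)"
  proof -
    have "t *\<^sub>R 1 - g = (t + 4) *\<^sub>R 1 - h" by (simp add: hg scaleR_add_left)
    then show ?thesis using t by (simp add: scaleR_diff_right)
  qed
  then have "norm (1 - (1 / (t + 4)) *\<^sub>R h) < 1" using t by (simp add: divide_simps)
  from Neumann_inverse[OF this] obtain k where
    k: "((1 / (t + 4)) *\<^sub>R h) * k = 1" "k * ((1 / (t + 4)) *\<^sub>R h) = 1" by blast
  obtain s where s: "spectrally_positive s" "s * s = h"
    using spectrally_positive_sqrt[OF hpos] by blast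
  have ss: "star s = s" using s(1) by (rule spectrally_positive_selfadjoint)
  \<comment> \<open>A left inverse of \<open>s\<close>, while \<open>r'\<close> is a right inverse.
    They coincide and are self-adjoint, so \<open>r\<close> is the inverse square root of
    \<open>h\<close>.\<close>
  define r where "r = k * ((1 / (t + 4)) *\<^sub>R s)"
  have rs: "r * s = 1" using k(2) s(2) by (simp add: r_def mult.assoc)
  define r' where "r' = ((1 / (t + 4)) *\<^sub>R s) * k"
  have sr': "s * r' = 1" using k(1) s(2) by (simp add: r'_def flip: mult.assoc)
  have "r = r'" using rs sr' by (metis mult.assoc mult.left_neutral mult.right_neutral)
  then have sr: "s * r = 1" using sr' by simp
  have "star r = r"
    using rs sr ss by (metis mult.assoc mult.left_neutral mult.right_neutral star_mult star_one)
  have "(\<Sum>i<n. inner (act r (x i + y i)) (act r (x i + y i))) = r * h * star r"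
    by (simp add: inner_act_left inner_act_right h_def sum_distrib_left sum_distrib_right mult.assoc)
  also have "\<dots> = r * s * (s * r)" by (simp add: \<open>star r = r\<close> mult.assoc flip: s(2))
  also have "\<dots> = 1" by (simp add: rs sr)
  finally show ?thesis by (rule that)
qed

section \<open>Embeddings onto full corners\<close>

text \<open>A *-isomorphism onto a full corner of a matrix algebra over an arbitrary finite index set;
  the projection is \<open>F 1\<close>.  Algebraic fullness is no restriction since a dense two-sided ideal
  contains the unit.\<close>

locale corner_embedding =
  fixes I :: "'i set" and F :: "'a::cstar_algebra \<Rightarrow> 'i \<Rightarrow> 'i \<Rightarrow> 'b::cstar_algebra"
  assumes finite_index: "finite I"
    and entry_add: "i \<in> I \<Longrightarrow> j \<in> I \<Longrightarrow> F (a + b) i j = F a i j + F b i j"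
    and entry_scaleC: "i \<in> I \<Longrightarrow> j \<in> I \<Longrightarrow> F (c *\<^sub>C a) i j = c *\<^sub>C F a i j"
    and entry_mult: "i \<in> I \<Longrightarrow> j \<in> I \<Longrightarrow> F (a * b) i j = (\<Sum>k\<in>I. F a i k * F b k j)"
    and entry_star: "i \<in> I \<Longrightarrow> j \<in> I \<Longrightarrow> F (star a) i j = star (F a j i)"
    and entry_inj: "(\<And>i j. i \<in> I \<Longrightarrow> j \<in> I \<Longrightarrow> F a i j = 0) \<Longrightarrow> a = 0"
    and entry_corner: "\<exists>a. \<forall>i\<in>I. \<forall>j\<in>I. F a i j = (\<Sum>u\<in>I. \<Sum>v\<in>I. F 1 i u * M u v * F 1 v j)"
    and entry_full: "two_sided_ideal J \<Longrightarrow> (\<And>i j. i \<in> I \<Longrightarrow> j \<in> I \<Longrightarrow> F 1 i j \<in> J) \<Longrightarrow> 1 \<in> J"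
begin

lemma entry_0: "i \<in> I \<Longrightarrow> j \<in> I \<Longrightarrow> F 0 i j = 0"
  using entry_add[of i j 0 0] by simp

lemma entry_sum: "i \<in> I \<Longrightarrow> j \<in> I \<Longrightarrow> F (sum f K) i j = (\<Sum>k\<in>K. F (f k) i j)"
  by (induction K rule: infinite_finite_induct) (simp_all add: entry_0 entry_add)

lemma entry_mult3:
  assumes "i \<in> I" "j \<in> I"
  shows "F (a * b * c) i j = (\<Sum>u\<in>I. \<Sum>v\<in>I. F a i u * F b u v * F c v j)"
proof -
  have "F (a * (b * c)) i j = (\<Sum>u\<in>I. F a i u * (\<Sum>v\<in>I. F b u v * F c v j))"
    using assms by (simp add: entry_mult)
  then show ?thesis by (simp add: sum_distrib_left mult.assoc)
qed

lemma entry_one_left: "i \<in> I \<Longrightarrow> j \<in> I \<Longrightarrow> (\<Sum>k\<in>I. F 1 i k * F a k j) = F a i j"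
  by (simp flip: entry_mult)

lemma entry_one_right: "i \<in> I \<Longrightarrow> j \<in> I \<Longrightarrow> (\<Sum>k\<in>I. F a i k * F 1 k j) = F a i j"
  by (simp flip: entry_mult)

end

lemma sum_swap_pairs:
  "(\<Sum>u\<in>A. \<Sum>v\<in>B. \<Sum>x\<in>C. \<Sum>y\<in>D. f u v x y) = (\<Sum>x\<in>C. \<Sum>y\<in>D. \<Sum>u\<in>A. \<Sum>v\<in>B. f u v x y)"
proof -
  have "(\<Sum>u\<in>A. \<Sum>v\<in>B. \<Sum>x\<in>C. \<Sum>y\<in>D. f u v x y) = (\<Sum>u\<in>A. \<Sum>x\<in>C. \<Sum>v\<in>B. \<Sum>y\<in>D. f u v x y)"
    by (rule sum.cong[OF refl], rule sum.swap)
  also have "\<dots> = (\<Sum>x\<in>C. \<Sum>u\<in>A. \<Sum>y\<in>D. \<Sum>v\<in>B. f u v x y)"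
    by (subst sum.swap, rule sum.cong[OF refl], rule sum.cong[OF refl], rule sum.swap)
  also have "\<dots> = (\<Sum>x\<in>C. \<Sum>y\<in>D. \<Sum>u\<in>A. \<Sum>v\<in>B. f u v x y)"
    by (rule sum.cong[OF refl], rule sum.swap)
  finally show ?thesis .
qed

text \<open>The matrix of matrices obtained by applying \<open>G\<close> to each entry of
  \<open>F a\<close>. Both the corner condition and fullness are pulled back in two stages through
  the middle algebra.\<close>

lemma corner_embedding_compose:
  fixes F :: "'a::cstar_algebra \<Rightarrow> 'i \<Rightarrow> 'i \<Rightarrow> 'b::cstar_algebra"
    and G :: "'b \<Rightarrow> 'j \<Rightarrow> 'j \<Rightarrow> 'c::cstar_algebra"
  assumes F: "corner_embedding I F" and G: "corner_embedding J G"
  shows "corner_embedding (I \<times> J) (\<lambda>a (i, j) (i', j'). G (F a i i') j j')"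
proof -
  interpret F: corner_embedding I F by (rule F)
  interpret G: corner_embedding J G by (rule G)
  let ?H = "\<lambda>a (i, j) (i', j'). G (F a i i') j j'"
  show ?thesis
  proof (rule corner_embedding.intro)
    show "finite (I \<times> J)" by (simp add: F.finite_index G.finite_index)
  next
    fix x y a b assume "x \<in> I \<times> J" "y \<in> I \<times> J"
    then show "?H (a + b) x y = ?H a x y + ?H b x y"
      by (auto simp: F.entry_add G.entry_add)
  next
    fix x y c a assume "x \<in> I \<times> J" "y \<in> I \<times> J"
    then show "?H (c *\<^sub>C a) x y = c *\<^sub>C ?H a x y"
      by (auto simp: F.entry_scaleC G.entry_scaleC)
  next
    fix x y a b assume "x \<in> I \<times> J" "y \<in> I \<times> J"
    then show "?H (a * b) x y = (\<Sum>k\<in>I \<times> J. ?H a x k * ?H b k y)"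
      by (auto simp: F.entry_mult G.entry_mult G.entry_sum sum.cartesian_product' split_def)
  next
    fix x y a assume "x \<in> I \<times> J" "y \<in> I \<times> J"
    then show "?H (star a) x y = star (?H a y x)"
      by (auto simp: F.entry_star G.entry_star)
  next
    fix a assume a: "\<And>x y. x \<in> I \<times> J \<Longrightarrow> y \<in> I \<times> J \<Longrightarrow> ?H a x y = 0"
    show "a = 0"
    proof (rule F.entry_inj, rule G.entry_inj)
      fix i i' j j' assume "i \<in> I" "i' \<in> I" "j \<in> J" "j' \<in> J"
      then show "G (F a i i') j j' = 0" using a[of "(i, j)" "(i', j')"] by simp
    qed
  next
    fix M :: "'i \<times> 'j \<Rightarrow> 'i \<times> 'j \<Rightarrow> 'c"
    \<comment> \<open>Each block of \<open>M\<close>, compressed by the projection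
      \<open>G 1\<close>, is lifted to the middle algebra; the matrix of lifts is then compressed by
      \<open>F 1\<close> and lifted once more.\<close>
    define b where "b i i' = (SOME b. \<forall>j\<in>J. \<forall>j'\<in>J.
        G b j j' = (\<Sum>u\<in>J. \<Sum>v\<in>J. G 1 j u * M (i, u) (i', v) * G 1 v j'))" for i i'
    have b: "G (b i i') j j' = (\<Sum>u\<in>J. \<Sum>v\<in>J. G 1 j u * M (i, u) (i', v) * G 1 v j')"
      if "j \<in> J" "j' \<in> J" for i i' j j'
      using someI_ex[OF G.entry_corner[of "\<lambda>u v. M (i, u) (i', v)"]] that unfolding b_def by blast
    obtain a where a: "\<And>i i'. i \<in> I \<Longrightarrow> i' \<in> I \<Longrightarrow>
        F a i i' = (\<Sum>u\<in>I. \<Sum>v\<in>I. F 1 i u * b u v * F 1 v i')"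
      using F.entry_corner[of b] by blast
    have "G (F a i i') j j' = (\<Sum>p\<in>I. \<Sum>x\<in>J. \<Sum>q\<in>I. \<Sum>y\<in>J.
        G (F 1 i p) j x * M (p, x) (q, y) * G (F 1 q i') y j')"
      if ij: "i \<in> I" "i' \<in> I" "j \<in> J" "j' \<in> J" for i i' j j'
    proof -
      \<comment> \<open>The extra factors \<open>G 1\<close> coming from the lifts are absorbed by
        the neighbouring matrices \<open>G (F 1 i p)\<close> and
        \<open>G (F 1 q i')\<close>.\<close>
      have "G (F 1 i p * b p q * F 1 q i') j j'
          = (\<Sum>x\<in>J. \<Sum>y\<in>J. G (F 1 i p) j x * M (p, x) (q, y) * G (F 1 q i') y j')"
        if "p \<in> I" "q \<in> I" for p q
      proof -
        have "G (F 1 i p * b p q * F 1 q i') j j'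
            = (\<Sum>u\<in>J. \<Sum>v\<in>J. \<Sum>x\<in>J. \<Sum>y\<in>J.
                (G (F 1 i p) j u * G 1 u x) * M (p, x) (q, y) * (G 1 y v * G (F 1 q i') v j'))"
          unfolding G.entry_mult3[OF ij(3,4)]
          by (rule sum.cong[OF refl], rule sum.cong[OF refl])
            (simp add: b sum_distrib_left sum_distrib_right mult.assoc)
        also have "\<dots> = (\<Sum>x\<in>J. \<Sum>y\<in>J. \<Sum>u\<in>J. \<Sum>v\<in>J.
                (G (F 1 i p) j u * G 1 u x) * M (p, x) (q, y) * (G 1 y v * G (F 1 q i') v j'))"
          by (rule sum_swap_pairs)
        also have "\<dots> = (\<Sum>x\<in>J. \<Sum>y\<in>J. (\<Sum>u\<in>J. G (F 1 i p) j u * G 1 u x) * M (p, x) (q, y)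
                * (\<Sum>v\<in>J. G 1 y v * G (F 1 q i') v j'))"
          by (rule sum.cong[OF refl], rule sum.cong[OF refl], subst sum.swap)
            (simp add: sum_distrib_left sum_distrib_right)
        finally show ?thesis
          using ij by (simp add: G.entry_one_left G.entry_one_right cong: sum.cong)
      qed
      then have "G (F a i i') j j' = (\<Sum>p\<in>I. \<Sum>q\<in>I. \<Sum>x\<in>J. \<Sum>y\<in>J.
          G (F 1 i p) j x * M (p, x) (q, y) * G (F 1 q i') y j')"
        using ij by (simp add: a G.entry_sum)
      also have "\<dots> = (\<Sum>p\<in>I. \<Sum>x\<in>J. \<Sum>q\<in>I. \<Sum>y\<in>J.
          G (F 1 i p) j x * M (p, x) (q, y) * G (F 1 q i') y j')"
        by (rule sum.cong[OF refl], rule sum.swap)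
      finally show ?thesis .
    qed
    then show "\<exists>a. \<forall>x\<in>I \<times> J. \<forall>y\<in>I \<times> J. ?H a x y
        = (\<Sum>u\<in>I \<times> J. \<Sum>v\<in>I \<times> J. ?H 1 x u * M u v * ?H 1 v y)"
      by (intro exI[of _ a]) (auto simp: sum.cartesian_product' split_def)
  next
    fix K :: "'c set"
    assume K: "two_sided_ideal K"
      and H: "\<And>x y. x \<in> I \<times> J \<Longrightarrow> y \<in> I \<times> J \<Longrightarrow> ?H 1 x y \<in> K"
    \<comment> \<open>The preimage of \<open>K\<close> in the middle algebra, again an ideal, so
      that fullness of \<open>F\<close> can be applied to it.\<close>
    define L where "L = {b. \<forall>j\<in>J. \<forall>j'\<in>J. G b j j' \<in> K}"
    have "two_sided_ideal L"
      unfolding two_sided_ideal_def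
    proof (intro conjI ballI allI)
      show "0 \<in> L" using K by (simp add: L_def G.entry_0 two_sided_ideal_def)
    next
      fix x a assume x: "x \<in> L"
      show "a * x \<in> L" using x
        by (auto simp: L_def G.entry_mult intro!: two_sided_ideal_sum[OF K] two_sided_ideal_mult_left[OF K])
      show "x * a \<in> L" using x
        by (auto simp: L_def G.entry_mult intro!: two_sided_ideal_sum[OF K] two_sided_ideal_mult_right[OF K])
    qed (auto simp: L_def G.entry_add intro: two_sided_ideal_add[OF K])
    moreover have "F 1 i i' \<in> L" if "i \<in> I" "i' \<in> I" for i i'
      unfolding L_def using H[of "(i, _)" "(i', _)"] that by auto
    ultimately have "1 \<in> L" by (rule F.entry_full)
    then show "1 \<in> K" by (intro G.entry_full[OF K]) (auto simp: L_def)
  qed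
qed

section \<open>Self-similar pairs as embeddings\<close>

lemma self_similar_pair_carrier:
  assumes "self_similar_pair k p \<Phi>"
  shows "\<Phi> a \<in> carrier_mat k k"
proof -
  have "\<Phi> a \<in> corner k p" "p \<in> carrier_mat k k"
    using assms by (auto simp: self_similar_pair_def star_iso_corner_def projection_mat_def bij_betw_def)
  then show ?thesis by (auto simp: corner_def)
qed

lemma index_mult_mat_sum:
  assumes "A \<in> carrier_mat n n" "B \<in> carrier_mat n n" "i < n" "j < n"
  shows "(A * B) $$ (i, j) = (\<Sum>k<n. A $$ (i, k) * B $$ (k, j))"
  using assms by (simp add: scalar_prod_def atLeast0LessThan)

lemma index_mult_mat3_sum:
  fixes A :: "'a::semiring_0 mat"
  assumes "A \<in> carrier_mat n n" "B \<in> carrier_mat n n" "C \<in> carrier_mat n n" "i < n" "j < n"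
  shows "(A * B * C) $$ (i, j) = (\<Sum>u<n. \<Sum>v<n. A $$ (i, u) * B $$ (u, v) * C $$ (v, j))"
proof -
  have "(A * B * C) $$ (i, j) = (\<Sum>v<n. \<Sum>u<n. A $$ (i, u) * B $$ (u, v) * C $$ (v, j))"
    using assms by (simp add: index_mult_mat_sum[of _ n] sum_distrib_right mult.assoc
        del: index_mult_mat assoc_mult_mat)
  then show ?thesis by (subst sum.swap)
qed

text \<open>By surjectivity \<open>p\<close> is some \<open>\<Phi> a\<close>. Both
  \<open>\<Phi> 1\<close> and \<open>p\<close> act as units of the corner, so they agree.\<close>

lemma self_similar_pair_one:
  assumes "self_similar_pair k p \<Phi>"
  shows "\<Phi> 1 = p"
proof -
  have p: "p \<in> carrier_mat k k" "p * p = p" and \<Phi>: "bij_betw \<Phi> UNIV (corner k p)"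
    "\<And>a b. \<Phi> (a * b) = \<Phi> a * \<Phi> b"
    using assms by (auto simp: self_similar_pair_def star_iso_corner_def projection_mat_def)
  have "p = p * p * p" using p by simp
  then have "p \<in> corner k p" unfolding corner_def using p(1) by blast
  then obtain a where a: "\<Phi> a = p" using \<Phi>(1) by (metis bij_betw_iff_bijections)
  have "\<Phi> 1 \<in> corner k p" using bij_betwE[OF \<Phi>(1)] by blast
  then obtain M where M: "\<Phi> 1 = p * M * p" "M \<in> carrier_mat k k"
    by (auto simp: corner_def)
  have "\<Phi> 1 = \<Phi> 1 * p" using M p by (metis assoc_mult_mat mult_carrier_mat)
  also have "\<dots> = p" using \<Phi>(2)[of 1 a] a by simp
  finally show ?thesis .
qed

text \<open>Fullness: an ideal containing all entries of \<open>p\<close> contains the products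
  whose span is dense, since each is a sum of entries of \<open>p\<close> with multipliers on both
  sides.\<close>

lemma self_similar_pair_corner_embedding:
  fixes \<Phi> :: "'a::cstar_algebra \<Rightarrow> 'a mat"
  assumes ssp: "self_similar_pair k p \<Phi>"
  shows "corner_embedding {..<k} (\<lambda>a i j. \<Phi> a $$ (i, j))"
proof -
  have p: "p \<in> carrier_mat k k" "p * p = p" and inj: "inj \<Phi>" and ran: "range \<Phi> = corner k p"
    and add: "\<And>a b. \<Phi> (a + b) = \<Phi> a + \<Phi> b" and sc: "\<And>c a. \<Phi> (c *\<^sub>C a) = map_mat (scaleC c) (\<Phi> a)"
    and mult: "\<And>a b. \<Phi> (a * b) = \<Phi> a * \<Phi> b" and st: "\<And>a. \<Phi> (star a) = mat_star (\<Phi> a)"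
    and full: "closure (cspan {scalar_prod (map_vec star a) (p *\<^sub>v b) | a b.
       a \<in> carrier_vec k \<and> b \<in> carrier_vec k}) = UNIV"
    using ssp by (auto simp: self_similar_pair_def star_iso_corner_def projection_mat_def bij_betw_def)
  note car = self_similar_pair_carrier[OF ssp]
  have dim: "dim_row (\<Phi> a) = k" "dim_col (\<Phi> a) = k" for a using car[of a] by auto
  have one: "\<Phi> 1 = p" by (rule self_similar_pair_one[OF ssp])
  show ?thesis
  proof (rule corner_embedding.intro)
    fix i j a b assume "i \<in> {..<k}" "j \<in> {..<k}"
    then show "\<Phi> (a + b) $$ (i, j) = \<Phi> a $$ (i, j) + \<Phi> b $$ (i, j)"
      by (simp add: add dim)
  next
    fix i j c a assume "i \<in> {..<k}" "j \<in> {..<k}"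
    then show "\<Phi> (c *\<^sub>C a) $$ (i, j) = c *\<^sub>C \<Phi> a $$ (i, j)"
      by (simp add: sc dim)
  next
    fix i j a b assume "i \<in> {..<k}" "j \<in> {..<k}"
    then show "\<Phi> (a * b) $$ (i, j) = (\<Sum>u<k. \<Phi> a $$ (i, u) * \<Phi> b $$ (u, j))"
      unfolding mult by (intro index_mult_mat_sum car) auto
  next
    fix i j a assume "i \<in> {..<k}" "j \<in> {..<k}"
    then show "\<Phi> (star a) $$ (i, j) = star (\<Phi> a $$ (j, i))"
      by (simp add: st mat_star_def dim)
  next
    fix a assume 0: "\<And>i j. i \<in> {..<k} \<Longrightarrow> j \<in> {..<k} \<Longrightarrow> \<Phi> a $$ (i, j) = 0"
    \<comment> \<open>The entries of \<open>\<Phi> 0\<close> vanish by homogeneity, with 0 written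
      as a zero multiple.\<close>
    have "\<Phi> (0 *\<^sub>C 0) $$ (i, j) = 0" if "i < k" "j < k" for i j
      unfolding sc using that by (simp add: dim)
    then have "\<Phi> a = \<Phi> 0" using 0 by (intro eq_matI) (auto simp: dim)
    then show "a = 0" using inj by (simp add: inj_eq)
  next
    fix M :: "nat \<Rightarrow> nat \<Rightarrow> 'a"
    define N where "N = mat k k (\<lambda>(i, j). M i j)"
    have N: "N \<in> carrier_mat k k" by (simp add: N_def)
    then have "p * N * p \<in> corner k p" by (auto simp: corner_def)
    then obtain a where a: "\<Phi> a = p * N * p" using ran by (metis rangeE)
    have "\<Phi> a $$ (i, j) = (\<Sum>u<k. \<Sum>v<k. \<Phi> 1 $$ (i, u) * M u v * \<Phi> 1 $$ (v, j))"
      if "i < k" "j < k" for i j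
      unfolding a one index_mult_mat3_sum[OF p(1) N p(1) that]
      by (intro sum.cong refl) (simp add: N_def)
    then show "\<exists>a. \<forall>i\<in>{..<k}. \<forall>j\<in>{..<k}. \<Phi> a $$ (i, j)
        = (\<Sum>u<k. \<Sum>v<k. \<Phi> 1 $$ (i, u) * M u v * \<Phi> 1 $$ (v, j))" by auto
  next
    fix J :: "'a set"
    assume J: "two_sided_ideal J"
      and entries: "\<And>i j. i \<in> {..<k} \<Longrightarrow> j \<in> {..<k} \<Longrightarrow> \<Phi> 1 $$ (i, j) \<in> J"
    show "1 \<in> J"
    proof (rule dense_two_sided_ideal[OF J _ full], clarify)
      fix a b :: "'a vec" assume ab: "a \<in> carrier_vec k" "b \<in> carrier_vec k"
      have "map_vec star a \<bullet> (p *\<^sub>v b) = (\<Sum>i<k. \<Sum>j<k. star (a $ i) * (p $$ (i, j) * b $ j))"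
        using ab p by (simp add: scalar_prod_def atLeast0LessThan sum_distrib_left)
      also have "\<dots> \<in> J"
        using entries unfolding one
        by (intro two_sided_ideal_sum[OF J] two_sided_ideal_mult_left[OF J]
            two_sided_ideal_mult_right[OF J]) auto
      finally show "map_vec star a \<bullet> (p *\<^sub>v b) \<in> J" .
    qed
  qed simp
qed

text \<open>Enumerating \<open>I\<close> turns the family of entries into a matrix. The span
  required to be dense is in fact an ideal containing the entries of the projection, hence the whole
  algebra.\<close>

lemma self_similar_pair_of_corner_embedding:
  fixes F :: "'a::cstar_algebra \<Rightarrow> 'i \<Rightarrow> 'i \<Rightarrow> 'a"
  assumes "corner_embedding I F"
  obtains k p \<Phi> where "self_similar_pair k p \<Phi>"
    "induced_map k \<Phi> = (\<lambda>\<phi> a. \<Sum>i\<in>I. blinfun_apply \<phi> (F a i i))"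
proof -
  interpret corner_embedding I F by (rule assms)
  define k where "k = card I"
  obtain e where e: "bij_betw e {..<k} I"
    unfolding k_def using ex_bij_betw_nat_finite[OF finite_index] by (auto simp: atLeast0LessThan)
  have eI: "e i \<in> I" if "i < k" for i using e that by (auto simp: bij_betw_def)
  have sum_e: "(\<Sum>u\<in>I. f u) = (\<Sum>u<k. f (e u))" for f :: "'i \<Rightarrow> 'c::comm_monoid_add"
    by (rule sum.reindex_bij_betw [OF e, symmetric])
  define \<Phi> where "\<Phi> a = mat k k (\<lambda>(i, j). F a (e i) (e j))" for a
  define p where "p = \<Phi> 1"
  have car: "\<Phi> a \<in> carrier_mat k k" for a by (simp add: \<Phi>_def)
  have ix: "\<Phi> a $$ (i, j) = F a (e i) (e j)" if "i < k" "j < k" for a i j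
    using that by (simp add: \<Phi>_def)
  have dim: "dim_row (\<Phi> a) = k" "dim_col (\<Phi> a) = k" for a by (simp_all add: \<Phi>_def)
  have mult: "\<Phi> (a * b) = \<Phi> a * \<Phi> b" for a b
  proof (rule eq_matI)
    fix i j assume "i < dim_row (\<Phi> a * \<Phi> b)" "j < dim_col (\<Phi> a * \<Phi> b)"
    then have ij: "i < k" "j < k" by (simp_all add: dim)
    show "\<Phi> (a * b) $$ (i, j) = (\<Phi> a * \<Phi> b) $$ (i, j)"
      unfolding index_mult_mat_sum[OF car car ij] using ij by (simp add: ix entry_mult eI sum_e)
  qed (simp_all add: dim)
  have st: "\<Phi> (star a) = mat_star (\<Phi> a)" for a
    by (rule eq_matI) (simp_all add: mat_star_def \<Phi>_def entry_star eI)
  have add: "\<Phi> (a + b) = \<Phi> a + \<Phi> b" for a b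
    by (rule eq_matI) (simp_all add: \<Phi>_def entry_add eI)
  have sc: "\<Phi> (c *\<^sub>C a) = map_mat (scaleC c) (\<Phi> a)" for c a
    by (rule eq_matI) (simp_all add: \<Phi>_def entry_scaleC eI)
  have proj: "projection_mat k p"
    unfolding projection_mat_def p_def by (simp add: car flip: mult st)
  have "inj \<Phi>"
  proof (rule injI)
    fix a b assume eq: "\<Phi> a = \<Phi> b"
    have "F (a - b) i j = 0" if ij: "i \<in> I" "j \<in> I" for i j
    proof -
      obtain i' j' where i': "i = e i'" "i' < k" "j = e j'" "j' < k"
        using ij e by (auto simp: bij_betw_def)
      have "F a i j = F b i j" using arg_cong[OF eq, of "\<lambda>M. M $$ (i', j')"] i' by (simp add: ix)
      then show ?thesis using entry_add[OF ij, of "a - b" b] by simp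
    qed
    then show "a = b" using entry_inj[of "a - b"] by simp
  qed
  moreover have "range \<Phi> = corner k p"
  proof (intro equalityI subsetI)
    fix N assume "N \<in> range \<Phi>"
    then obtain a where "N = \<Phi> a" by auto
    then have "N = p * \<Phi> a * p" by (simp add: p_def flip: mult)
    then show "N \<in> corner k p" using car by (auto simp: corner_def)
  next
    fix N assume "N \<in> corner k p"
    then obtain M where M: "N = p * M * p" "M \<in> carrier_mat k k" by (auto simp: corner_def)
    \<comment> \<open>Inverse of the enumeration: \<open>M\<close> is indexed by numbers, while
      \<open>entry_corner\<close> expects indices in \<open>I\<close>.\<close>
    define d where "d = inv_into {..<k} e"
    have d: "d (e i) = i" if "i < k" for i
      unfolding d_def using e that by (simp add: bij_betw_def inv_into_f_f)
    obtain a where a: "\<And>i j. i \<in> I \<Longrightarrow> j \<in> I \<Longrightarrow>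
        F a i j = (\<Sum>u\<in>I. \<Sum>v\<in>I. F 1 i u * M $$ (d u, d v) * F 1 v j)"
      using entry_corner[of "\<lambda>u v. M $$ (d u, d v)"] by blast
    have "N = \<Phi> a"
    proof (rule eq_matI)
      fix i j assume "i < dim_row (\<Phi> a)" "j < dim_col (\<Phi> a)"
      then have ij: "i < k" "j < k" using car[of a] by auto
      have "(p * M * p) $$ (i, j) = (\<Sum>u<k. \<Sum>v<k. p $$ (i, u) * M $$ (u, v) * p $$ (v, j))"
        by (rule index_mult_mat3_sum) (use M ij car in \<open>auto simp: p_def\<close>)
      also have "\<dots> = (\<Sum>u<k. \<Sum>v<k. F 1 (e i) (e u) * M $$ (d (e u), d (e v)) * F 1 (e v) (e j))"
        by (intro sum.cong refl) (use ij in \<open>auto simp: p_def ix d\<close>)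
      also have "\<dots> = \<Phi> a $$ (i, j)"
        unfolding ix[OF ij] a[OF eI eI, OF ij] sum_e ..
      finally show "N $$ (i, j) = \<Phi> a $$ (i, j)" by (simp add: M)
    qed (use M car[of a] car[of 1] in \<open>auto simp: p_def\<close>)
    then show "N \<in> range \<Phi>" by simp
  qed
  ultimately have "star_iso_corner k p \<Phi>"
    unfolding star_iso_corner_def bij_betw_def using add sc mult st by auto
  moreover have "closure (cspan {map_vec star a \<bullet> (p *\<^sub>v b) | a b.
       a \<in> carrier_vec k \<and> b \<in> carrier_vec k}) = UNIV" (is "closure (cspan ?S) = UNIV")
  proof -
    have pc: "p \<in> carrier_mat k k" by (simp add: p_def car)
    have prod: "map_vec star a \<bullet> (p *\<^sub>v b) = (\<Sum>i<k. \<Sum>j<k. star (a $ i) * (p $$ (i, j) * b $ j))"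
      if "a \<in> carrier_vec k" "b \<in> carrier_vec k" for a b
      using that pc by (simp add: scalar_prod_def atLeast0LessThan sum_distrib_left)
    \<comment> \<open>A multiplier on either side is absorbed into the corresponding vector, so the
      set of products is stable under it even before taking the span.\<close>
    have left: "x * s \<in> ?S" if s: "s \<in> ?S" for x s
    proof -
      obtain a b where ab: "a \<in> carrier_vec k" "b \<in> carrier_vec k" "s = map_vec star a \<bullet> (p *\<^sub>v b)"
        using s by blast
      define a' where "a' = vec k (\<lambda>i. a $ i * star x)"
      have "x * s = map_vec star a' \<bullet> (p *\<^sub>v b)"
        unfolding ab(3) using ab by (simp add: prod a'_def star_mult star_star sum_distrib_left mult.assoc)
      moreover have "a' \<in> carrier_vec k" by (simp add: a'_def)
      ultimately show ?thesis using ab(2) by blast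
    qed
    have right: "s * x \<in> ?S" if s: "s \<in> ?S" for x s
    proof -
      obtain a b where ab: "a \<in> carrier_vec k" "b \<in> carrier_vec k" "s = map_vec star a \<bullet> (p *\<^sub>v b)"
        using s by blast
      define b' where "b' = vec k (\<lambda>i. b $ i * x)"
      have "s * x = map_vec star a \<bullet> (p *\<^sub>v b')"
        unfolding ab(3) using ab by (simp add: prod b'_def sum_distrib_right mult.assoc)
      moreover have "b' \<in> carrier_vec k" by (simp add: b'_def)
      ultimately show ?thesis using ab(1) by blast
    qed
    have lr: "x * s \<in> cspan ?S \<and> s * x \<in> cspan ?S" if "s \<in> cspan ?S" for x s
      using that
    proof (induction rule: complex_vector.span_induct_alt)
      case base
      show ?case by (simp add: complex_vector.span_zero)
    next
      case (step c u v)
      have "x * u \<in> cspan ?S" "u * x \<in> cspan ?S"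
        using left[OF step(1)] right[OF step(1)] by (simp_all add: complex_vector.span_base)
      then show ?case using step(2)
        by (simp add: distrib_left distrib_right scaleC_mult_left scaleC_mult_right
            complex_vector.span_add complex_vector.span_scale)
    qed
    have ideal: "two_sided_ideal (cspan ?S)"
      unfolding two_sided_ideal_def
      using lr by (auto intro: complex_vector.span_zero complex_vector.span_add)
    have "1 \<in> cspan ?S"
    proof (rule entry_full[OF ideal])
      fix i j assume "i \<in> I" "j \<in> I"
      then obtain i' j' where i': "i = e i'" "i' < k" "j = e j'" "j' < k"
        using e by (auto simp: bij_betw_def)
      \<comment> \<open>Unit vectors pick out a single entry of the projection.\<close>
      have "map_vec star (unit_vec k i') \<bullet> (p *\<^sub>v unit_vec k j')
          = (\<Sum>u<k. \<Sum>v<k. if u = i' then if v = j' then p $$ (u, v) else 0 else 0)"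
        using i' by (subst prod) (auto intro!: sum.cong simp: unit_vec_def)
      also have "\<dots> = (\<Sum>u<k. if u = i' then (\<Sum>v<k. if v = j' then p $$ (u, v) else 0) else 0)"
        by (intro sum.cong) auto
      also have "\<dots> = p $$ (i', j')" using i' by simp
      also have "\<dots> = F 1 i j" using i' by (simp add: p_def ix)
      finally have "F 1 i j \<in> ?S" by (metis (mono_tags, lifting) mem_Collect_eq unit_vec_carrier)
      then show "F 1 i j \<in> cspan ?S" by (rule complex_vector.span_base)
    qed
    then have "cspan ?S = UNIV"
      using two_sided_ideal_mult_left[OF ideal, of 1] by auto
    then show ?thesis by simp
  qed
  ultimately have "self_similar_pair k p \<Phi>"
    unfolding self_similar_pair_def using proj by blast
  moreover have "induced_map k \<Phi> = (\<lambda>\<phi> a. \<Sum>i\<in>I. blinfun_apply \<phi> (F a i i))"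
    by (intro ext) (simp add: induced_map_def ix sum_e)
  ultimately show ?thesis by (rule that)
qed

section \<open>Morita contexts with Parseval frames\<close>

text \<open>The part of an imprimitivity bimodule that is used.  No scalar multiplication on the bimodule
  occurs, so that the conjugate bimodule lives on the same type and the locale is self-dual.\<close>

locale morita_context =
  fixes lact :: "'a::cstar_algebra \<Rightarrow> 'x::ab_group_add \<Rightarrow> 'x"
    and ract :: "'x \<Rightarrow> 'b::cstar_algebra \<Rightarrow> 'x"
    and linner :: "'x \<Rightarrow> 'x \<Rightarrow> 'a"
    and rinner :: "'x \<Rightarrow> 'x \<Rightarrow> 'b"
    and z :: "nat \<Rightarrow> 'x" and l :: nat and w :: "nat \<Rightarrow> 'x" and m :: nat
  assumes lact_add_left: "lact (a + a') x = lact a x + lact a' x"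
    and lact_add_right: "lact a (x + y) = lact a x + lact a y"
    and lact_mult: "lact (a * a') x = lact a (lact a' x)"
    and lact_one: "lact 1 x = x"
    and ract_add_left: "ract (x + y) b = ract x b + ract y b"
    and ract_add_right: "ract x (b + b') = ract x b + ract x b'"
    and ract_mult: "ract x (b * b') = ract (ract x b) b'"
    and ract_one: "ract x 1 = x"
    and act_commute: "ract (lact a x) b = lact a (ract x b)"
    and act_scalar: "lact (c *\<^sub>C 1) x = ract x (c *\<^sub>C 1)"
    and linner_add_left: "linner (x + y) v = linner x v + linner y v"
    and linner_lact: "linner (lact a x) y = a * linner x y"
    and star_linner: "star (linner x y) = linner y x"
    and linner_ract: "linner (ract x b) y = linner x (ract y (star b))"
    and linner_positive: "cpositive (linner x x)"
    and rinner_add_right: "rinner v (x + y) = rinner v x + rinner v y"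
    and rinner_ract: "rinner x (ract y b) = rinner x y * b"
    and star_rinner: "star (rinner x y) = rinner y x"
    and rinner_lact: "rinner (lact a x) y = rinner x (lact (star a) y)"
    and rinner_positive: "cpositive (rinner x x)"
    and linner_rinner: "lact (linner x y) v = ract x (rinner y v)"
    and left_frame: "(\<Sum>i<l. linner (z i) (z i)) = 1"
    and right_frame: "(\<Sum>i<m. rinner (w i) (w i)) = 1"
begin

lemma linner_add_right: "linner v (x + y) = linner v x + linner v y"
  by (metis star_linner linner_add_left star_add)

lemma rinner_add_left: "rinner (x + y) v = rinner x v + rinner y v"
  by (metis star_rinner rinner_add_right star_add)

lemma linner_lact_right: "linner x (lact a y) = linner x y * star a"
  by (metis star_linner linner_lact star_mult)

lemma rinner_ract_left: "rinner (ract x b) y = star b * rinner x y"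
  by (metis star_rinner rinner_ract star_mult)

lemma rinner_lact_right: "rinner x (lact a y) = rinner (lact (star a) x) y"
  by (simp add: rinner_lact star_star)

lemma lact_0: "lact 0 x = 0"
  using lact_add_left[of 0 0 x] by simp

lemma ract_zero: "ract x 0 = 0"
  using ract_add_right[of x 0 0] by simp

lemma rinner_zero: "rinner x 0 = 0"
  using rinner_add_right[of x 0 0] by simp

lemma linner_zero: "linner 0 x = 0"
  using linner_add_left[of 0 0 x] by simp

lemma lact_sum: "lact (sum f I) x = (\<Sum>i\<in>I. lact (f i) x)"
  by (induction I rule: infinite_finite_induct) (simp_all add: lact_0 lact_add_left)

lemma rinner_sum: "rinner x (sum f I) = (\<Sum>i\<in>I. rinner x (f i))"
  by (induction I rule: infinite_finite_induct) (simp_all add: rinner_zero rinner_add_right)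

text \<open>The conjugate bimodule: the algebras, inner products and frames change places, and
  adjoints turn right actions into left ones. Every later result thereby also holds from
  \<open>B\<close> to \<open>A\<close>.\<close>

lemma dual: "morita_context (\<lambda>b x. ract x (star b)) (\<lambda>x a. lact (star a) x) rinner linner w m z l"
proof
  fix x y v
  show "ract v (star (rinner x y)) = lact (star (linner y v)) x"
    by (simp add: star_rinner star_linner linner_rinner)
qed (simp_all add: lact_add_left lact_add_right lact_mult lact_one ract_add_left ract_add_right
    ract_mult ract_one act_commute act_scalar linner_add_right linner_lact_right star_linner
    linner_ract linner_positive rinner_add_left rinner_ract_left star_rinner rinner_lact
    rinner_positive left_frame right_frame star_add star_mult star_star star_scaleC)

text \<open>Though normalized in \<open>A\<close>, the frame \<open>z\<close> reconstructs vectors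
  with coefficients in \<open>B\<close>: \<open>linner_rinner\<close> turns each summand into
  \<open>lact (linner (z i) (z i)) x\<close>.\<close>

lemma frame_expansion: "(\<Sum>i<l. ract (z i) (rinner (z i) x)) = x"
proof -
  have "(\<Sum>i<l. ract (z i) (rinner (z i) x)) = lact (\<Sum>i<l. linner (z i) (z i)) x"
    by (simp add: lact_sum linner_rinner)
  then show ?thesis by (simp add: left_frame lact_one)
qed

lemma rinner_frame: "rinner x y = (\<Sum>i<l. rinner x (z i) * rinner (z i) y)"
proof -
  have "rinner x y = rinner x (\<Sum>i<l. ract (z i) (rinner (z i) y))"
    by (simp add: frame_expansion)
  then show ?thesis by (simp add: rinner_sum rinner_ract)
qed

text \<open>The matrix of \<open>lact a\<close> in frame coordinates. At \<open>a = 1\<close> it is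
  the Gram matrix of the frame, which becomes the projection of the corner.\<close>

definition frame_entry :: "'a \<Rightarrow> nat \<Rightarrow> nat \<Rightarrow> 'b" where
  "frame_entry a i j = rinner (z i) (lact a (z j))"

text \<open>A scalar crosses from \<open>A\<close> to \<open>B\<close> as a multiple of the unit, by
  \<open>act_scalar\<close>.\<close>

lemma rinner_lact_scaleC: "rinner x (lact (c *\<^sub>C a) y) = c *\<^sub>C rinner x (lact a y)"
proof -
  have "lact (c *\<^sub>C a) y = lact (c *\<^sub>C 1) (lact a y)"
    by (simp add: scaleC_mult_left flip: lact_mult)
  then show ?thesis by (simp add: act_scalar rinner_ract scaleC_mult_right)
qed

lemma rinner_lact_scaleR: "rinner x (lact (c *\<^sub>R a) y) = c *\<^sub>R rinner x (lact a y)"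
  by (simp add: scaleR_scaleC rinner_lact_scaleC)

text \<open>Multiplicativity is the Parseval identity \<open>rinner_frame\<close>. The left frame
  gives faithfulness, the right frame fullness.\<close>

lemma corner_embedding_frame_entry: "corner_embedding {..<l} frame_entry"
proof (rule corner_embedding.intro)
  fix i j a b
  have "frame_entry (a * b) i j = rinner (lact (star a) (z i)) (lact b (z j))"
    by (simp add: frame_entry_def lact_mult rinner_lact star_star)
  also have "\<dots> = (\<Sum>k<l. frame_entry a i k * frame_entry b k j)"
    by (subst rinner_frame) (simp add: frame_entry_def rinner_lact star_star)
  finally show "frame_entry (a * b) i j = (\<Sum>k<l. frame_entry a i k * frame_entry b k j)" .
next
  fix i j a
  show "frame_entry (star a) i j = star (frame_entry a j i)"
    by (simp add: frame_entry_def star_rinner rinner_lact)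
next
  fix a assume 0: "\<And>i j. i \<in> {..<l} \<Longrightarrow> j \<in> {..<l} \<Longrightarrow> frame_entry a i j = 0"
  have "rinner (z i) (lact a x) = 0" if "i < l" for i x
  proof -
    have "rinner (z i) (lact a x) = rinner (lact (star a) (z i)) x"
      by (rule rinner_lact_right)
    also have "\<dots> = (\<Sum>j<l. frame_entry a i j * rinner (z j) x)"
      by (subst rinner_frame) (simp add: frame_entry_def rinner_lact_right)
    also have "\<dots> = 0" using 0 that by simp
    finally show ?thesis .
  qed
  then have "lact a x = 0" for x
    using frame_expansion[of "lact a x"] by (simp add: ract_zero)
  \<comment> \<open>An element that acts as zero is zero: by the left frame it is the sum of the
    \<open>linner (lact a (z i)) (z i)\<close>.\<close>
  then have "(\<Sum>i<l. a * linner (z i) (z i)) = 0"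
    by (simp add: linner_zero flip: linner_lact)
  then show "a = 0" by (simp add: left_frame flip: sum_distrib_left)
next
  fix M :: "nat \<Rightarrow> nat \<Rightarrow> 'b"
  \<comment> \<open>\<open>linner x y\<close> acts on the bimodule as a rank-one operator, so this
    is the operator with coefficient matrix \<open>M\<close> in the frame.\<close>
  define a where "a = (\<Sum>u<l. \<Sum>v<l. linner (ract (z u) (M u v)) (z v))"
  have "frame_entry a i j = (\<Sum>u<l. \<Sum>v<l. frame_entry 1 i u * M u v * frame_entry 1 v j)" for i j
    by (simp add: a_def frame_entry_def lact_sum rinner_sum linner_rinner rinner_ract lact_one)
  then show "\<exists>a. \<forall>i\<in>{..<l}. \<forall>j\<in>{..<l}. frame_entry a i j
      = (\<Sum>u<l. \<Sum>v<l. frame_entry 1 i u * M u v * frame_entry 1 v j)" by blast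
next
  fix J :: "'b set"
  assume J: "two_sided_ideal J"
    and entries: "\<And>i j. i \<in> {..<l} \<Longrightarrow> j \<in> {..<l} \<Longrightarrow> frame_entry 1 i j \<in> J"
  \<comment> \<open>Expanding both arguments in the frame puts every value of \<open>rinner\<close>
    into the ideal generated by the Gram entries.\<close>
  have expand: "rinner x y = (\<Sum>i<l. \<Sum>j<l. rinner x (z i) * (frame_entry 1 i j * rinner (z j) y))" for x y
  proof -
    have eq: "rinner (z i) y = (\<Sum>j<l. frame_entry 1 i j * rinner (z j) y)" for i
      by (subst rinner_frame) (simp add: frame_entry_def lact_one)
    show ?thesis by (simp only: sum_distrib_left [symmetric] eq [symmetric] rinner_frame [of x y])
  qed
  have "rinner x y \<in> J" for x y
    unfolding expand[of x y] using entries
    by (intro two_sided_ideal_sum[OF J] two_sided_ideal_mult_left[OF J]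
        two_sided_ideal_mult_right[OF J])
  then show "1 \<in> J" unfolding right_frame [symmetric] by (intro two_sided_ideal_sum[OF J])
qed (simp_all add: frame_entry_def lact_add_left rinner_add_right rinner_lact_scaleC)

text \<open>A crude bound that makes the transfer continuous: a factor 3 for self-adjoint elements,
  doubled for the real and imaginary parts.\<close>

lemma norm_rinner_lact_le: "norm (rinner x (lact a x)) \<le> 6 * norm (rinner x x) * norm a"
proof -
  have pos: "spectrally_positive (rinner x (lact (star s * s) x))" for s
    using rinner_positive[of "lact s x"]
    by (simp add: cpositive_iff_spectrally_positive lact_mult rinner_lact star_star)
  have sa: "norm (rinner x (lact u x)) \<le> 3 * norm (rinner x x) * norm u" if u: "star u = u" for u
  proof -
    \<comment> \<open>\<open>P u\<close> and \<open>P (- u)\<close> are positive with sum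
      \<open>(2 * norm u) *\<^sub>R rinner x x\<close>, so \<open>P u\<close> is dominated in norm
      by that sum; removing the shift by \<open>norm u\<close> adds the third unit to the factor
      3.\<close>
    define P where "P v = rinner x (lact (norm u *\<^sub>R 1 + v) x)" for v
    have Pv: "P v = norm u *\<^sub>R rinner x x + rinner x (lact v x)" for v
      by (simp add: P_def lact_add_left rinner_add_right rinner_lact_scaleR lact_one)
    have P: "spectrally_positive (P v)" if v: "star v = v" "norm v = norm u" for v
    proof -
      have "spectrally_positive (norm u *\<^sub>R 1 - (- v))"
        using v by (intro spectrally_positive_norm_diff) auto
      then obtain s where "norm u *\<^sub>R 1 + v = star s * s"
        using cpositive_iff_spectrally_positive cpositive_def by (metis diff_minus_eq_add)
      then show ?thesis by (simp add: P_def pos)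
    qed
    have "rinner x (lact (- u) x) = - rinner x (lact u x)"
      using rinner_lact_scaleR[of x "-1" u x] by simp
    then have "P u + P (- u) = (2 * norm u) *\<^sub>R rinner x x"
      by (simp add: Pv scaleR_2 flip: scaleR_scaleR)
    moreover have "norm (P u) \<le> norm (P u + P (- u))"
      using u by (intro spectrally_positive_norm_mono P) auto
    ultimately have "norm (P u) \<le> 2 * norm u * norm (rinner x x)" by simp
    moreover have "norm (rinner x (lact u x)) \<le> norm (P u) + norm u * norm (rinner x x)"
      using norm_triangle_ineq4[of "P u" "norm u *\<^sub>R rinner x x"] by (simp add: Pv)
    ultimately show ?thesis by (simp add: algebra_simps)
  qed
  obtain u v where uv: "star u = u" "star v = v" "norm u \<le> norm a" "norm v \<le> norm a"
    "a = u + \<i> *\<^sub>C v" by (rule selfadjoint_decomposition)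
  have "rinner x (lact a x) = rinner x (lact u x) + \<i> *\<^sub>C rinner x (lact v x)"
    unfolding uv(5) by (simp add: lact_add_left rinner_add_right rinner_lact_scaleC)
  then have "norm (rinner x (lact a x)) \<le> norm (rinner x (lact u x)) + norm (rinner x (lact v x))"
    using norm_triangle_ineq[of "rinner x (lact u x)" "\<i> *\<^sub>C rinner x (lact v x)"]
    by (simp add: norm_scaleC)
  also have "\<dots> \<le> 3 * norm (rinner x x) * norm a + 3 * norm (rinner x x) * norm a"
    using uv(3,4)
    by (intro add_mono order_trans[OF sa[OF uv(1)]] order_trans[OF sa[OF uv(2)]] mult_left_mono) auto
  finally show ?thesis by (simp add: mult_ac)
qed

text \<open>The pullback of the unnormalized matrix trace over \<open>\<psi>\<close> along the frame
  embedding. \<open>Blinfun\<close> is meaningful because of the preceding norm bound.\<close>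

definition transfer :: "('b \<Rightarrow>\<^sub>L complex) \<Rightarrow> ('a \<Rightarrow>\<^sub>L complex)" where
  "transfer \<psi> = Blinfun (\<lambda>a. \<Sum>i<l. blinfun_apply \<psi> (frame_entry a i i))"

lemma transfer_apply: "blinfun_apply (transfer \<psi>) a = (\<Sum>i<l. blinfun_apply \<psi> (frame_entry a i i))"
proof -
  have "bounded_linear (\<lambda>a. rinner (z i) (lact a (z i)))" for i
    by (rule bounded_linear_intro[where K = "6 * norm (rinner (z i) (z i))"])
      (use norm_rinner_lact_le in
        \<open>simp_all add: lact_add_left rinner_add_right rinner_lact_scaleR mult.commute\<close>)
  then have "bounded_linear (\<lambda>a. \<Sum>i<l. blinfun_apply \<psi> (frame_entry a i i))"
    unfolding frame_entry_def
    by (intro bounded_linear_sum bounded_linear_compose[OF blinfun.bounded_linear_right])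
  then show ?thesis unfolding transfer_def by (simp add: bounded_linear_Blinfun_apply)
qed

lemma transfer_add: "transfer (\<psi> + \<chi>) = transfer \<psi> + transfer \<chi>"
  by (rule blinfun_eqI) (simp add: transfer_apply blinfun.add_left sum.distrib)

lemma transfer_scaleC: "transfer (c *\<^sub>C \<psi>) = c *\<^sub>C transfer \<psi>"
  by (rule blinfun_eqI)
    (simp add: transfer_apply scaleC_blinfun.rep_eq complex_vector.scale_sum_right)

lemma trace_commute: "\<psi> \<in> traces \<Longrightarrow> blinfun_apply \<psi> (b * b') = blinfun_apply \<psi> (b' * b)"
  by (simp add: traces_def)

text \<open>The trace property reverses the two factors, and the Parseval identity then sums out the
  frame.\<close>

lemma transfer_linner:
  assumes "\<psi> \<in> traces"
  shows "blinfun_apply (transfer \<psi>) (linner x y) = blinfun_apply \<psi> (rinner y x)"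
proof -
  have "blinfun_apply (transfer \<psi>) (linner x y)
      = (\<Sum>i<l. blinfun_apply \<psi> (rinner (z i) x * rinner y (z i)))"
    by (simp add: transfer_apply frame_entry_def linner_rinner rinner_ract)
  also have "\<dots> = (\<Sum>i<l. blinfun_apply \<psi> (rinner y (z i) * rinner (z i) x))"
    by (rule sum.cong[OF refl], rule trace_commute[OF assms])
  also have "\<dots> = blinfun_apply \<psi> (rinner y x)"
    by (simp add: rinner_frame[of y x] blinfun.sum_right)
  finally show ?thesis .
qed

lemma transfer_traces:
  assumes \<psi>: "\<psi> \<in> traces"
  shows "transfer \<psi> \<in> traces"
proof -
  interpret corner_embedding "{..<l}" frame_entry by (rule corner_embedding_frame_entry)
  have "blinfun_apply (transfer \<psi>) (a * b) = blinfun_apply (transfer \<psi>) (b * a)" for a b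
  proof -
    have "blinfun_apply (transfer \<psi>) (a * b)
        = (\<Sum>i<l. \<Sum>j<l. blinfun_apply \<psi> (frame_entry b j i * frame_entry a i j))"
      by (simp add: transfer_apply entry_mult blinfun.sum_right trace_commute[OF \<psi>, of "frame_entry a _ _"])
    also have "\<dots> = (\<Sum>j<l. \<Sum>i<l. blinfun_apply \<psi> (frame_entry b j i * frame_entry a i j))"
      by (rule sum.swap)
    finally show ?thesis by (simp add: transfer_apply entry_mult blinfun.sum_right)
  qed
  moreover have "blinfun_apply (transfer \<psi>) (c *\<^sub>C a) = c * blinfun_apply (transfer \<psi>) a" for c a
    using \<psi> by (simp add: transfer_apply entry_scaleC traces_def sum_distrib_left)
  ultimately show ?thesis by (simp add: traces_def)
qed

lemma transfer_positive:
  assumes \<psi>: "\<And>b. cpositive b \<Longrightarrow> blinfun_apply \<psi> b \<in> \<real>\<^sub>\<ge>\<^sub>0" and "cpositive a"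
  shows "blinfun_apply (transfer \<psi>) a \<in> \<real>\<^sub>\<ge>\<^sub>0"
proof -
  obtain s where s: "a = star s * s" using assms(2) by (auto simp: cpositive_def)
  have "frame_entry a i i = rinner (lact s (z i)) (lact s (z i))" for i
    by (simp add: s frame_entry_def lact_mult rinner_lact)
  then have "cpositive (frame_entry a i i)" for i
    by (simp add: rinner_positive)
  then have "blinfun_apply \<psi> (frame_entry a i i) \<in> \<real>\<^sub>\<ge>\<^sub>0" for i using \<psi> by blast
  then show ?thesis
    unfolding transfer_apply by (induction l) (auto intro: nonneg_Reals_add_I)
qed

section \<open>Invertibility of the transfer\<close>

abbreviation "dual_entry \<equiv> morita_context.frame_entry (\<lambda>b x. ract x (star b)) linner w"
abbreviation "dual_transfer \<equiv> morita_context.transfer (\<lambda>b x. ract x (star b)) linner w m"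

lemma dual_entry: "dual_entry b i j = linner (ract (w i) b) (w j)"
proof -
  interpret dual: morita_context "\<lambda>b x. ract x (star b)" "\<lambda>x a. lact (star a) x" rinner linner w m z l
    by (rule dual)
  show ?thesis by (simp add: dual.frame_entry_def linner_ract)
qed

text \<open>By \<open>transfer_linner\<close> the frame \<open>z\<close> has disappeared after the
  first transfer; what remains is the normalization of \<open>w\<close>.\<close>

lemma dual_transfer_transfer:
  assumes "\<psi> \<in> traces"
  shows "dual_transfer (transfer \<psi>) = \<psi>"
proof (rule blinfun_eqI)
  interpret dual: morita_context "\<lambda>b x. ract x (star b)" "\<lambda>x a. lact (star a) x" rinner linner w m z l
    by (rule dual)
  fix b
  have "blinfun_apply (dual_transfer (transfer \<psi>)) b
      = (\<Sum>i<m. blinfun_apply \<psi> (rinner (w i) (ract (w i) b)))"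
    by (simp add: dual.transfer_apply dual_entry transfer_linner[OF assms])
  also have "\<dots> = blinfun_apply \<psi> ((\<Sum>i<m. rinner (w i) (w i)) * b)"
    by (simp add: rinner_ract sum_distrib_right blinfun.sum_right)
  finally show "blinfun_apply (dual_transfer (transfer \<psi>)) b = blinfun_apply \<psi> b"
    by (simp add: right_frame)
qed

lemma transfer_dual_transfer:
  assumes "\<phi> \<in> traces"
  shows "transfer (dual_transfer \<phi>) = \<phi>"
proof -
  interpret dual: morita_context "\<lambda>b x. ract x (star b)" "\<lambda>x a. lact (star a) x" rinner linner w m z l
    by (rule dual)
  \<comment> \<open>The dual of the dual context is the original one up to a double adjoint.\<close>
  show ?thesis using dual.dual_transfer_transfer[OF assms] by (simp add: star_star)
qed

end

text \<open>That the units act trivially comes from definiteness: the vectors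
  \<open>lact 1 x - x\<close> and \<open>ract x 1 - x\<close> have zero inner square.\<close>

lemma imprimitivity_bimodule_morita_context:
  assumes "imprimitivity_bimodule lact ract linner rinner"
  obtains z l w m where "morita_context lact ract linner rinner z l w m"
proof -
  interpret imprimitivity_bimodule lact ract linner rinner by (rule assms)
  obtain z l where z: "(\<Sum>i<(l::nat). linner (z i) (z i)) = 1"
    by (rule Parseval_frame[OF left.inner_add_left left.inner_act_left left.star_inner
          left.inner_positive left.inner_full])
  have radd: "rinner (x + y) v = rinner x v + rinner y v" for x y v
    by (metis right.star_inner right.inner_add_right star_add)
  have ract: "rinner (ract x (star b)) y = b * rinner x y" for x y b
    by (metis right.star_inner right.inner_act_right star_mult star_star)
  obtain w m where w: "(\<Sum>i<(m::nat). rinner (w i) (w i)) = 1"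
    by (rule Parseval_frame[OF radd ract right.star_inner right.inner_positive right.inner_full])
  have lsc: "linner (u - v) y = linner u y - linner v y" for u v y
    using left.inner_add_left[of "u - v" v y] by simp
  have rsc: "rinner y (u - v) = rinner y u - rinner y v" for u v y
    using right.inner_add_right[of y "u - v" v] by simp
  have lone: "lact 1 x = x" for x
  proof -
    have "linner (lact 1 x - x) (lact 1 x - x) = 0"
      by (subst lsc) (simp add: left.inner_act_left)
    then show ?thesis using left.inner_definite by fastforce
  qed
  have rone: "ract x 1 = x" for x
  proof -
    have "rinner (ract x 1 - x) (ract x 1 - x) = 0"
      by (subst rsc) (simp add: right.inner_act_right)
    then show ?thesis using right.inner_definite by fastforce
  qed
  have "morita_context lact ract linner rinner z l w m"
    by standard
      (simp_all add: left.act_add_left left.act_add_right left.act_mult lone right.act_add_left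
        right.act_add_right right.act_mult rone act_commute left.act_scaleC_left
        right.act_scaleC_right left.inner_add_left left.inner_act_left left.star_inner linner_ract
        left.inner_positive right.inner_add_right right.inner_act_right right.star_inner rinner_lact
        right.inner_positive linner_rinner z w)
  then show ?thesis by (rule that)
qed

section \<open>Positive traces and their extreme points\<close>

definition positive_functional :: "('a::cstar_algebra \<Rightarrow>\<^sub>L complex) \<Rightarrow> bool" where
  "positive_functional \<phi> \<longleftrightarrow> (\<forall>a. cpositive a \<longrightarrow> blinfun_apply \<phi> a \<in> \<real>\<^sub>\<ge>\<^sub>0)"

text \<open>Positivity of \<open>norm u *\<^sub>R 1 - u\<close> bounds the functional on
  self-adjoint \<open>u\<close> by its value at 1. The real part on a general element is its value
  on the real part of that element.\<close>

lemma positive_functional_one: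
  fixes \<phi> :: "'a::cstar_algebra \<Rightarrow>\<^sub>L complex"
  assumes hom: "\<And>c a. blinfun_apply \<phi> (c *\<^sub>C a) = c * blinfun_apply \<phi> a"
    and pos: "positive_functional \<phi>"
  shows "blinfun_apply \<phi> 1 = complex_of_real (norm \<phi>)"
proof -
  have pos': "blinfun_apply \<phi> a \<in> \<real>\<^sub>\<ge>\<^sub>0" if "spectrally_positive a" for a
    using pos that by (simp add: positive_functional_def cpositive_iff_spectrally_positive)
  define r where "r = Re (blinfun_apply \<phi> 1)"
  have "spectrally_positive (1::'a)" using spectrally_positive_star_mult[of "1::'a"] by simp
  then have r: "blinfun_apply \<phi> 1 = complex_of_real r" "r \<ge> 0"
    using pos'[of 1] by (auto simp: r_def complex_nonneg_Reals_iff complex_eq_iff)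
  have sa: "Im (blinfun_apply \<phi> u) = 0" "Re (blinfun_apply \<phi> u) \<le> r * norm u" if "star u = u" for u
    using pos'[OF spectrally_positive_norm_diff[OF that order_refl]]
    by (auto simp: blinfun.diff_right blinfun.scaleR_right r(1) complex_nonneg_Reals_iff mult.commute)
  have Re_le: "Re (blinfun_apply \<phi> a) \<le> r * norm a" for a
  proof -
    obtain u v where uv: "star u = u" "star v = v" "norm u \<le> norm a" "a = u + \<i> *\<^sub>C v"
      by (rule selfadjoint_decomposition)
    have "Re (blinfun_apply \<phi> a) = Re (blinfun_apply \<phi> u)"
      unfolding uv(4) using sa(1)[OF uv(2)] by (simp add: blinfun.add_right hom)
    also have "\<dots> \<le> r * norm u" by (rule sa(2)[OF uv(1)])
    also have "\<dots> \<le> r * norm a" using uv(3) r(2) by (rule mult_left_mono)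
    finally show ?thesis .
  qed
  have "norm (blinfun_apply \<phi> a) \<le> r * norm a" for a
  proof (cases "blinfun_apply \<phi> a = 0")
    case False
    \<comment> \<open>A phase that rotates the value at \<open>a\<close> onto the nonnegative reals,
      so that the bound on real parts bounds the modulus.\<close>
    define c where "c = cnj (blinfun_apply \<phi> a) / cmod (blinfun_apply \<phi> a)"
    have "cnj x * x = complex_of_real (cmod x) * complex_of_real (cmod x)" for x
      using complex_norm_square[of x] by (simp add: power2_eq_square mult.commute)
    then have "c * blinfun_apply \<phi> a = complex_of_real (cmod (blinfun_apply \<phi> a))"
      using False by (simp add: c_def)
    moreover have "cmod c = 1" using False by (simp add: c_def norm_divide)
    ultimately show ?thesis using Re_le[of "c *\<^sub>C a"] by (simp add: hom norm_scaleC)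
  qed (use r(2) in simp)
  then have "norm \<phi> \<le> r" using r(2) by (intro norm_blinfun_bound)
  moreover have "r \<le> norm \<phi>" using norm_blinfun[of \<phi> 1] r by simp
  ultimately show ?thesis using r by simp
qed

text \<open>Replaces the norm condition by an affine one, suited to convex combinations.\<close>

lemma positive_traces1_iff:
  "\<phi> \<in> positive_traces1 \<longleftrightarrow> \<phi> \<in> traces \<and> positive_functional \<phi> \<and> blinfun_apply \<phi> 1 = 1"
  using positive_functional_one[of \<phi>]
  by (auto simp: positive_traces1_def positive_functional_def traces_def)

lemma extreme_traces_positive: "\<psi> \<in> extreme_traces \<Longrightarrow> \<psi> \<in> positive_traces1"
  by (simp add: extreme_traces_def extreme_point_of_def)

lemma traces_scaleR: "\<phi> \<in> traces \<Longrightarrow> r *\<^sub>R \<phi> \<in> traces"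
  by (auto simp: traces_def blinfun.scaleR_left)

lemma positive_functional_scaleR: "positive_functional \<phi> \<Longrightarrow> r \<ge> 0 \<Longrightarrow> positive_functional (r *\<^sub>R \<phi>)"
  by (auto simp: positive_functional_def blinfun.scaleR_left complex_nonneg_Reals_iff)

lemma subspace_traces: "complex_vector.subspace traces"
  by (auto simp: complex_vector.subspace_def traces_def blinfun.add_left scaleC_blinfun.rep_eq
      scaleC_complex_def algebra_simps)

text \<open>An order isomorphism of trace spaces together with its inverse. The axioms are
  symmetric, so each result also holds with \<open>T\<close> and \<open>S\<close> exchanged.\<close>

locale trace_equivalence =
  fixes T :: "('b::cstar_algebra \<Rightarrow>\<^sub>L complex) \<Rightarrow> ('a::cstar_algebra \<Rightarrow>\<^sub>L complex)"
    and S :: "('a \<Rightarrow>\<^sub>L complex) \<Rightarrow> ('b \<Rightarrow>\<^sub>L complex)"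
  assumes T_add: "T (\<psi> + \<psi>') = T \<psi> + T \<psi>'" and S_add: "S (\<phi> + \<phi>') = S \<phi> + S \<phi>'"
    and T_scaleC: "T (c *\<^sub>C \<psi>) = c *\<^sub>C T \<psi>" and S_scaleC: "S (c *\<^sub>C \<phi>) = c *\<^sub>C S \<phi>"
    and T_traces: "\<psi> \<in> traces \<Longrightarrow> T \<psi> \<in> traces" and S_traces: "\<phi> \<in> traces \<Longrightarrow> S \<phi> \<in> traces"
    and S_T: "\<psi> \<in> traces \<Longrightarrow> S (T \<psi>) = \<psi>" and T_S: "\<phi> \<in> traces \<Longrightarrow> T (S \<phi>) = \<phi>"
    and T_positive: "positive_functional \<psi> \<Longrightarrow> positive_functional (T \<psi>)"
    and S_positive: "positive_functional \<phi> \<Longrightarrow> positive_functional (S \<phi>)"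
begin

lemma swap: "trace_equivalence S T"
  by standard (simp_all add: T_add S_add T_scaleC S_scaleC T_traces S_traces S_T T_S T_positive S_positive)

lemma T_scaleR: "T (r *\<^sub>R \<psi>) = r *\<^sub>R T \<psi>"
  by (simp add: scaleR_scaleC T_scaleC)

lemma S_scaleR: "S (r *\<^sub>R \<phi>) = r *\<^sub>R S \<phi>"
  by (simp add: scaleR_scaleC S_scaleC)

lemma trace_dim_eq: "trace_dim TYPE('b) = trace_dim TYPE('a)"
proof -
  interpret vector_space_pair "scaleC :: complex \<Rightarrow> ('b \<Rightarrow>\<^sub>L complex) \<Rightarrow> _"
    "scaleC :: complex \<Rightarrow> ('a \<Rightarrow>\<^sub>L complex) \<Rightarrow> _"
    by unfold_locales
  have lin: "Vector_Spaces.linear scaleC scaleC T"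
    by unfold_locales (simp_all add: T_add T_scaleC)
  obtain B where B: "B \<subseteq> (traces :: ('b \<Rightarrow>\<^sub>L complex) set)" "complex_vector.independent B"
    "traces \<subseteq> cspan B" "card B = cdim (traces :: ('b \<Rightarrow>\<^sub>L complex) set)"
    by (rule complex_vector.basis_exists)
  have span: "cspan B = traces"
    using B(1,3) complex_vector.span_minimal[OF B(1) subspace_traces] by blast
  have inj: "inj_on T traces" using S_T by (rule inj_on_inverseI)
  have "complex_vector.independent (T ` B)"
    using linear_independent_injective_image[OF lin B(2)] inj span by (simp add: cspan_def)
  moreover have "T ` B \<subseteq> traces" using B(1) T_traces by blast
  moreover have "(traces :: ('a \<Rightarrow>\<^sub>L complex) set) \<subseteq> cspan (T ` B)"
  proof
    fix \<phi> :: "'a \<Rightarrow>\<^sub>L complex" assume "\<phi> \<in> traces"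
    then have "\<phi> = T (S \<phi>)" "S \<phi> \<in> cspan B" by (simp_all add: T_S span S_traces)
    moreover have "T ` cspan B \<subseteq> cspan (T ` B)"
      using linear_spans_image[OF lin, of "cspan B" B] by (simp add: cspan_def)
    ultimately show "\<phi> \<in> cspan (T ` B)" by (metis image_subset_iff)
  qed
  ultimately have "card (T ` B) = cdim (traces :: ('a \<Rightarrow>\<^sub>L complex) set)"
    by (intro complex_vector.basis_card_eq_dim)
  moreover have "card (T ` B) = card B" using inj B(1) by (intro card_image) (rule inj_on_subset)
  ultimately show ?thesis using B(4) by (simp add: trace_dim_def)
qed

text \<open>\<open>T\<close> preserves the cone of positive traces but not its base of norm-one
  elements; rescaling returns to the base.\<close>

definition normalize :: "('b \<Rightarrow>\<^sub>L complex) \<Rightarrow> ('a \<Rightarrow>\<^sub>L complex)" where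
  "normalize \<psi> = (1 / norm (T \<psi>)) *\<^sub>R T \<psi>"

lemma
  assumes "\<psi> \<in> positive_traces1"
  shows norm_T_pos: "norm (T \<psi>) > 0"
    and normalize_positive_traces1: "normalize \<psi> \<in> positive_traces1"
    and T_eq_normalize: "T \<psi> = norm (T \<psi>) *\<^sub>R normalize \<psi>"
proof -
  have \<psi>: "\<psi> \<in> traces" "positive_functional \<psi>" "blinfun_apply \<psi> 1 = 1"
    using assms by (auto simp: positive_traces1_iff)
  have "T \<psi> \<noteq> 0"
  proof
    assume "T \<psi> = 0"
    then have "\<psi> = 0" using S_T[OF \<psi>(1)] S_scaleR[of 0 0] by simp
    then show False using \<psi>(3) by simp
  qed
  then show pos: "norm (T \<psi>) > 0" by simp
  have T: "T \<psi> \<in> traces" "positive_functional (T \<psi>)" using \<psi> T_traces T_positive by auto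
  have "blinfun_apply (T \<psi>) 1 = complex_of_real (norm (T \<psi>))"
    by (rule positive_functional_one[OF _ T(2)]) (use T(1) in \<open>simp add: traces_def\<close>)
  then have "blinfun_apply (normalize \<psi>) 1 = 1"
    using pos by (simp add: normalize_def blinfun.scaleR_left scaleR_conv_of_real flip: of_real_mult)
  then show "normalize \<psi> \<in> positive_traces1"
    using T by (simp add: positive_traces1_iff normalize_def traces_scaleR positive_functional_scaleR)
  show "T \<psi> = norm (T \<psi>) *\<^sub>R normalize \<psi>" using pos by (simp add: normalize_def)
qed

text \<open>An open segment through \<open>normalize \<psi>\<close> is carried by \<open>S\<close>,
  after rescaling its endpoints, to an open segment through \<open>\<psi>\<close>.\<close>

lemma normalize_extreme:
  assumes "\<psi> \<in> extreme_traces"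
  shows "normalize \<psi> \<in> extreme_traces"
proof -
  interpret swap: trace_equivalence S T by (rule swap)
  have \<psi>: "\<psi> \<in> positive_traces1" and ext: "\<And>\<alpha> \<beta>. \<alpha> \<in> positive_traces1 \<Longrightarrow>
      \<beta> \<in> positive_traces1 \<Longrightarrow> \<psi> \<notin> open_segment \<alpha> \<beta>"
    using assms by (auto simp: extreme_traces_def extreme_point_of_def)
  have "normalize \<psi> \<notin> open_segment \<alpha> \<beta>"
    if \<alpha>: "\<alpha> \<in> positive_traces1" and \<beta>: "\<beta> \<in> positive_traces1" for \<alpha> \<beta>
  proof
    assume "normalize \<psi> \<in> open_segment \<alpha> \<beta>"
    then obtain t where t: "\<alpha> \<noteq> \<beta>" "0 < t" "t < 1" "normalize \<psi> = (1 - t) *\<^sub>R \<alpha> + t *\<^sub>R \<beta>"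
      by (auto simp: in_segment)
    define d where "d = norm (T \<psi>)"
    define a where "a = norm (S \<alpha>)"
    define b where "b = norm (S \<beta>)"
    define \<alpha>' where "\<alpha>' = swap.normalize \<alpha>"
    define \<beta>' where "\<beta>' = swap.normalize \<beta>"
    have dab: "d > 0" "a > 0" "b > 0"
      unfolding d_def a_def b_def by (rule norm_T_pos swap.norm_T_pos \<psi> \<alpha> \<beta>)+
    have S\<alpha>: "S \<alpha> = a *\<^sub>R \<alpha>'" and S\<beta>: "S \<beta> = b *\<^sub>R \<beta>'"
      unfolding a_def b_def \<alpha>'_def \<beta>'_def by (rule swap.T_eq_normalize \<alpha> \<beta>)+
    have P: "\<alpha>' \<in> positive_traces1" "\<beta>' \<in> positive_traces1"
      unfolding \<alpha>'_def \<beta>'_def by (rule swap.normalize_positive_traces1 \<alpha> \<beta>)+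
    have one: "blinfun_apply \<psi> 1 = 1" "blinfun_apply \<alpha> 1 = 1" "blinfun_apply \<beta> 1 = 1"
      "blinfun_apply \<alpha>' 1 = 1" "blinfun_apply \<beta>' 1 = 1"
      using \<psi> \<alpha> \<beta> P by (simp_all add: positive_traces1_iff)
    have "\<psi> = S (d *\<^sub>R normalize \<psi>)"
      using T_eq_normalize[OF \<psi>] S_T[of \<psi>] \<psi> by (simp add: d_def positive_traces1_iff)
    also have "\<dots> = (d * (1 - t) * a) *\<^sub>R \<alpha>' + (d * t * b) *\<^sub>R \<beta>'"
      unfolding t(4) by (simp add: S_scaleR S_add S\<alpha> S\<beta> scaleR_add_right)
    finally have eq: "\<psi> = (d * (1 - t) * a) *\<^sub>R \<alpha>' + (d * t * b) *\<^sub>R \<beta>'" .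
    \<comment> \<open>Evaluation at the unit shows that the two positive coefficients form a convex
      combination.\<close>
    have "complex_of_real (d * (1 - t) * a + d * t * b) = 1"
      using arg_cong[OF eq, of "\<lambda>\<chi>. blinfun_apply \<chi> 1"]
      by (simp add: one blinfun.add_left blinfun.scaleR_left scaleR_conv_of_real)
    then have sum: "d * (1 - t) * a + d * t * b = 1" by (simp only: of_real_eq_1_iff)
    \<comment> \<open>If the endpoints coincided, \<open>\<alpha>\<close> and \<open>\<beta>\<close>
      would be proportional, hence equal, as both take the value 1 at the unit.\<close>
    have "\<alpha>' \<noteq> \<beta>'"
    proof
      assume "\<alpha>' = \<beta>'"
      then have "b *\<^sub>R S \<alpha> = a *\<^sub>R S \<beta>" by (simp add: S\<alpha> S\<beta>)
      then have "T (b *\<^sub>R S \<alpha>) = T (a *\<^sub>R S \<beta>)" by simp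
      then have ba: "b *\<^sub>R \<alpha> = a *\<^sub>R \<beta>"
        using \<alpha> \<beta> by (simp add: T_scaleR T_S positive_traces1_iff)
      have "a = b"
        using arg_cong[OF ba, of "\<lambda>\<chi>. blinfun_apply \<chi> 1"]
        by (simp add: one blinfun.scaleR_left scaleR_conv_of_real)
      then show False using ba dab t(1) by simp
    qed
    moreover have coeff: "d * (1 - t) * a = 1 - d * t * b" using sum by linarith
    moreover have "\<psi> = (1 - d * t * b) *\<^sub>R \<alpha>' + (d * t * b) *\<^sub>R \<beta>'"
      using eq unfolding coeff .
    moreover have "0 < d * t * b" "0 < d * (1 - t) * a" using dab t(2,3) by simp_all
    ultimately have "\<psi> \<in> open_segment \<alpha>' \<beta>'"
      unfolding in_segment by (intro conjI exI[of _ "d * t * b"]) linarith+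
    then show False using ext[OF P] by blast
  qed
  then show ?thesis
    using normalize_positive_traces1[OF \<psi>] by (auto simp: extreme_traces_def extreme_point_of_def)
qed

lemma normalize_inverse:
  assumes "\<psi> \<in> positive_traces1"
  shows "trace_equivalence.normalize S (normalize \<psi>) = \<psi>"
proof -
  interpret swap: trace_equivalence S T by (rule swap)
  have \<psi>: "\<psi> \<in> traces" "norm \<psi> = 1" using assms by (simp_all add: positive_traces1_def)
  have "S (normalize \<psi>) = (1 / norm (T \<psi>)) *\<^sub>R \<psi>"
    by (simp add: normalize_def S_scaleR S_T \<psi>)
  then show ?thesis using norm_T_pos[OF assms] \<psi> by (simp add: swap.normalize_def)
qed

lemma bij_betw_normalize: "bij_betw normalize extreme_traces extreme_traces"
proof -
  interpret swap: trace_equivalence S T by (rule swap)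
  show ?thesis
    by (rule bij_betw_byWitness[where f' = swap.normalize])
      (auto intro!: normalize_inverse swap.normalize_inverse normalize_extreme swap.normalize_extreme
        extreme_traces_positive)
qed

lemma trace_indexing_normalize:
  assumes "trace_indexing \<psi>"
  shows "trace_indexing (normalize \<circ> \<psi>)"
  using bij_betw_trans[OF assms[unfolded trace_indexing_def] bij_betw_normalize]
  by (simp add: trace_indexing_def trace_dim_eq)

text \<open>The monomial form of \<open>T\<close>: \<open>\<pi> j\<close> is the index of
  \<open>normalize (\<psi> j)\<close> among the \<open>\<phi>\<close>, and \<open>d j\<close> is the
  norm lost in normalizing.\<close>

lemma trace_indexing_correspondence:
  assumes \<phi>: "trace_indexing \<phi>" and \<psi>: "trace_indexing \<psi>"
  obtains \<pi> d where "bij_betw \<pi> {..<trace_dim TYPE('a)} {..<trace_dim TYPE('a)}"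
    "\<And>j. j < trace_dim TYPE('a) \<Longrightarrow> d j > 0"
    "\<And>j. j < trace_dim TYPE('a) \<Longrightarrow> T (\<psi> j) = d j *\<^sub>R \<phi> (\<pi> j)"
    "\<And>j. j < trace_dim TYPE('a) \<Longrightarrow> \<psi> j \<in> traces"
proof -
  define n where "n = trace_dim TYPE('a)"
  have \<phi>': "bij_betw \<phi> {..<n} extreme_traces" and \<psi>': "bij_betw \<psi> {..<n} extreme_traces"
    using \<phi> \<psi> by (simp_all add: trace_indexing_def n_def trace_dim_eq)
  define \<pi> where "\<pi> = inv_into {..<n} \<phi> \<circ> (normalize \<circ> \<psi>)"
  have N: "bij_betw (normalize \<circ> \<psi>) {..<n} extreme_traces"
    by (rule bij_betw_trans[OF \<psi>' bij_betw_normalize])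
  have "bij_betw \<pi> {..<n} {..<n}"
    unfolding \<pi>_def by (rule bij_betw_trans[OF N bij_betw_inv_into[OF \<phi>']])
  moreover have P: "\<psi> j \<in> positive_traces1" if "j < n" for j
    using \<psi>' that by (auto simp: bij_betw_def intro: extreme_traces_positive)
  moreover have "\<phi> (\<pi> j) = normalize (\<psi> j)" if "j < n" for j
    unfolding \<pi>_def using bij_betw_inv_into_right[OF \<phi>'] N that by (auto simp: bij_betw_def)
  then have "T (\<psi> j) = norm (T (\<psi> j)) *\<^sub>R \<phi> (\<pi> j)" if "j < n" for j
    using T_eq_normalize[OF P] that by simp
  ultimately show ?thesis
    using norm_T_pos by (intro that[of \<pi> "\<lambda>j. norm (T (\<psi> j))"]) (auto simp: n_def positive_traces1_def)
qed

end

lemma (in morita_context) trace_equivalence: "trace_equivalence transfer dual_transfer"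
proof -
  interpret dual: morita_context "\<lambda>b x. ract x (star b)" "\<lambda>x a. lact (star a) x" rinner linner w m z l
    by (rule dual)
  show ?thesis
    by standard
      (simp_all add: transfer_add dual.transfer_add transfer_scaleC dual.transfer_scaleC
        transfer_traces dual.transfer_traces dual_transfer_transfer transfer_dual_transfer
        positive_functional_def transfer_positive dual.transfer_positive)
qed

section \<open>Transfer of the fundamental group\<close>

text \<open>The map induced by the composite embedding is \<open>dual_transfer\<close> after the
  given induced map after \<open>transfer\<close>. The matrix \<open>C\<close> is described by its
  entries so that the same statement applies in the dual context with inverse permutation and
  reciprocal weights.\<close>

lemma (in morita_context) fundamental_group_transfer:
  fixes \<phi> :: "nat \<Rightarrow> ('a \<Rightarrow>\<^sub>L complex)" and \<psi> :: "nat \<Rightarrow> ('b \<Rightarrow>\<^sub>L complex)"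
  defines "n \<equiv> trace_dim TYPE('a)"
  assumes B: "B \<in> fundamental_group \<phi>"
    and \<psi>: "\<And>j. j < n \<Longrightarrow> \<psi> j \<in> traces"
    and \<pi>: "bij_betw \<pi> {..<n} {..<n}"
    and d: "\<And>j. j < n \<Longrightarrow> d j > 0"
    and T: "\<And>j. j < n \<Longrightarrow> transfer (\<psi> j) = d j *\<^sub>R \<phi> (\<pi> j)"
    and C: "C \<in> carrier_mat n n"
    and C_entry: "\<And>i j. i < n \<Longrightarrow> j < n \<Longrightarrow> C $$ (i, j) = d j / d i * B $$ (\<pi> i, \<pi> j)"
  shows "C \<in> fundamental_group \<psi>"
proof -
  interpret dual: morita_context "\<lambda>b x. ract x (star b)" "\<lambda>x a. lact (star a) x" rinner linner w m z l
    by (rule dual)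
  have n: "trace_dim TYPE('b) = n"
    using trace_equivalence.trace_dim_eq[OF trace_equivalence] by (simp add: n_def)
  obtain k p \<Phi> where ssp: "self_similar_pair k p \<Phi>"
    and \<Phi>: "\<And>j. j < n \<Longrightarrow> induced_map k \<Phi> (\<phi> j) =
      (\<lambda>a. \<Sum>i<n. complex_of_real (B $$ (i, j)) * blinfun_apply (\<phi> i) a)"
    using B by (auto simp: fundamental_group_def n_def)
  \<comment> \<open>The chain B -> M_m(A) -> M_mk(A) -> M_mkl(B): the dual frame embedding, the
    given pair applied entrywise, and the frame embedding back.\<close>
  note embedding = corner_embedding_compose[OF
      corner_embedding_compose[OF dual.corner_embedding_frame_entry self_similar_pair_corner_embedding[OF ssp]]
      corner_embedding_frame_entry]
  obtain k' p' \<Phi>' where ssp': "self_similar_pair k' p' \<Phi>'"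
    and \<Phi>': "induced_map k' \<Phi>' = (\<lambda>\<chi> b. \<Sum>x\<in>({..<m} \<times> {..<k}) \<times> {..<l}.
      blinfun_apply \<chi> ((case x of (i, j) \<Rightarrow> \<lambda>(i', j'). frame_entry ((case i of (i, j) \<Rightarrow>
        \<lambda>(i', j'). \<Phi> (dual_entry b i i') $$ (j, j')) i') j j') x))"
    by (rule self_similar_pair_of_corner_embedding[OF embedding])
  have S: "dual_transfer (\<phi> (\<pi> i)) = (1 / d i) *\<^sub>R \<psi> i" if "i < n" for i
  proof -
    have "\<phi> (\<pi> i) = (1 / d i) *\<^sub>R transfer (\<psi> i)" using T[OF that] d[OF that] by simp
    then show ?thesis
      using dual_transfer_transfer[OF \<psi>[OF that]] by (simp add: scaleR_scaleC dual.transfer_scaleC)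
  qed
  have "induced_map k' \<Phi>' (\<psi> j)
      = (\<lambda>b. \<Sum>i<n. complex_of_real (C $$ (i, j)) * blinfun_apply (\<psi> i) b)" if j: "j < n" for j
  proof
    fix b
    have \<pi>j: "\<pi> j < n" using \<pi> j by (auto simp: bij_betw_def)
    have "induced_map k' \<Phi>' (\<psi> j) b
        = (\<Sum>i<m. \<Sum>r<k. blinfun_apply (transfer (\<psi> j)) (\<Phi> (dual_entry b i i) $$ (r, r)))"
      by (simp add: \<Phi>' transfer_apply sum.cartesian_product' split_def)
    also have "\<dots> = (\<Sum>i<m. complex_of_real (d j) * induced_map k \<Phi> (\<phi> (\<pi> j)) (dual_entry b i i))"
      by (simp add: T[OF j] induced_map_def blinfun.scaleR_left scaleR_conv_of_real sum_distrib_left)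
    also have "\<dots> = (\<Sum>i<m. \<Sum>h<n. complex_of_real (d j * B $$ (h, \<pi> j))
        * blinfun_apply (\<phi> h) (dual_entry b i i))"
      by (simp add: \<Phi>[OF \<pi>j] sum_distrib_left mult.assoc)
    also have "\<dots> = (\<Sum>h<n. complex_of_real (d j * B $$ (h, \<pi> j)) * blinfun_apply (dual_transfer (\<phi> h)) b)"
      by (subst sum.swap) (simp add: dual.transfer_apply sum_distrib_left)
    \<comment> \<open>Reindexing the basis by \<open>\<pi>\<close>, because \<open>S\<close>
      evaluates the dual transfer on \<open>\<phi> (\<pi> i)\<close>.\<close>
    also have "\<dots> = (\<Sum>i<n. complex_of_real (d j * B $$ (\<pi> i, \<pi> j))
        * blinfun_apply (dual_transfer (\<phi> (\<pi> i))) b)"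
      by (rule sum.reindex_bij_betw[OF \<pi>, symmetric])
    also have "\<dots> = (\<Sum>i<n. complex_of_real (C $$ (i, j)) * blinfun_apply (\<psi> i) b)"
      using j by (intro sum.cong refl)
        (simp add: S C_entry blinfun.scaleR_left scaleR_conv_of_real)
    finally show "induced_map k' \<Phi>' (\<psi> j) b
        = (\<Sum>i<n. complex_of_real (C $$ (i, j)) * blinfun_apply (\<psi> i) b)" .
  qed
  then show ?thesis
    unfolding fundamental_group_def n using C ssp' by blast
qed

section \<open>Monomial matrices\<close>

lemma sum_singleton_support:
  fixes f :: "nat \<Rightarrow> real"
  assumes "a < n" "\<And>u. u < n \<Longrightarrow> u \<noteq> a \<Longrightarrow> f u = 0"
  shows "(\<Sum>u<n. f u) = f a"
proof -
  have "(\<Sum>u<n. f u) = (\<Sum>u\<in>{a}. f u)"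
    using assms by (intro sum.mono_neutral_right) auto
  then show ?thesis by simp
qed

text \<open>Column \<open>j\<close> expresses that \<psi>_j goes to \<open>d j\<close> times \<phi>
  with index \<open>\<pi> j\<close>: this is the matrix of the transfer in the two bases.\<close>

definition monomial_mat :: "nat \<Rightarrow> (nat \<Rightarrow> nat) \<Rightarrow> (nat \<Rightarrow> real) \<Rightarrow> real mat" where
  "monomial_mat n \<pi> d = mat n n (\<lambda>(i, j). if i = \<pi> j then d j else 0)"

definition monomial_mat_inv :: "nat \<Rightarrow> (nat \<Rightarrow> nat) \<Rightarrow> (nat \<Rightarrow> real) \<Rightarrow> real mat" where
  "monomial_mat_inv n \<pi> d = mat n n (\<lambda>(i, j). if j = \<pi> i then 1 / d i else 0)"

lemma monomial_mat_carrier: "monomial_mat n \<pi> d \<in> carrier_mat n n" "monomial_mat_inv n \<pi> d \<in> carrier_mat n n"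
  by (simp_all add: monomial_mat_def monomial_mat_inv_def)

context
  fixes n :: nat and \<pi> :: "nat \<Rightarrow> nat" and d :: "nat \<Rightarrow> real"
  assumes \<pi>: "bij_betw \<pi> {..<n} {..<n}" and d: "\<forall>j<n. d j > 0"
begin

private abbreviation "W \<equiv> monomial_mat n \<pi> d"
private abbreviation "W' \<equiv> monomial_mat_inv n \<pi> d"

private lemma \<pi>_less: "i < n \<Longrightarrow> \<pi> i < n"
  using \<pi> by (auto simp: bij_betw_def)

private lemma \<pi>_eq: "i < n \<Longrightarrow> j < n \<Longrightarrow> \<pi> i = \<pi> j \<longleftrightarrow> i = j"
  using \<pi> by (auto simp: bij_betw_def inj_on_def)

lemma monomial_mat_conj:
  assumes "M \<in> carrier_mat n n" "i < n" "j < n"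
  shows "(W' * M * W) $$ (i, j) = d j / d i * M $$ (\<pi> i, \<pi> j)"
proof -
  have "(W' * M * W) $$ (i, j) = (\<Sum>u<n. \<Sum>v<n. W' $$ (i, u) * M $$ (u, v) * W $$ (v, j))"
    by (rule index_mult_mat3_sum) (use assms monomial_mat_carrier in auto)
  also have "\<dots> = (\<Sum>v<n. W' $$ (i, \<pi> i) * M $$ (\<pi> i, v) * W $$ (v, j))"
    using assms by (intro sum_singleton_support) (auto simp: monomial_mat_inv_def \<pi>_less)
  also have "\<dots> = W' $$ (i, \<pi> i) * M $$ (\<pi> i, \<pi> j) * W $$ (\<pi> j, j)"
    using assms by (intro sum_singleton_support) (auto simp: monomial_mat_def \<pi>_less)
  also have "\<dots> = d j / d i * M $$ (\<pi> i, \<pi> j)"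
    using assms by (simp add: monomial_mat_def monomial_mat_inv_def \<pi>_less)
  finally show ?thesis .
qed

lemma monomial_mat_inv_mult: "W' * W = 1\<^sub>m n"
proof (rule eq_matI)
  fix i j assume "i < dim_row (1\<^sub>m n :: real mat)" "j < dim_col (1\<^sub>m n :: real mat)"
  then have ij: "i < n" "j < n" by simp_all
  have "(W' * W) $$ (i, j) = (W' * 1\<^sub>m n * W) $$ (i, j)"
    unfolding right_mult_one_mat[OF monomial_mat_carrier(2)] ..
  also have "\<dots> = 1\<^sub>m n $$ (i, j)"
    using monomial_mat_conj[OF one_carrier_mat ij] ij d[rule_format, OF ij(1)]
    by (auto simp: \<pi>_less \<pi>_eq)
  finally show "(W' * W) $$ (i, j) = 1\<^sub>m n $$ (i, j)" .
qed (use monomial_mat_carrier[of n \<pi> d] in auto)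

lemma monomial_mat_mult: "W * W' = 1\<^sub>m n"
  using mat_mult_left_right_inverse[OF monomial_mat_carrier(2,1) monomial_mat_inv_mult] .

lemma det_monomial_mat_conj:
  assumes "M \<in> carrier_mat n n"
  shows "Determinant.det (W' * M * W) = Determinant.det M"
proof -
  have "Determinant.det W' * Determinant.det W = Determinant.det (W' * W)"
    by (rule det_mult[symmetric]) (rule monomial_mat_carrier)+
  then have "Determinant.det W' * Determinant.det W = 1" by (simp add: monomial_mat_inv_mult)
  moreover have "Determinant.det (W' * M * W)
      = Determinant.det W' * Determinant.det M * Determinant.det W"
    using assms monomial_mat_carrier[of n \<pi> d] by (simp add: det_mult[of _ n])
  ultimately show ?thesis by (simp add: mult_ac)
qed

text \<open>\<open>perm_matrix\<close> has its ones where \<open>j = \<sigma> i\<close>, so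
  \<open>\<sigma>\<close> must be the inverse of \<open>\<pi>\<close>. The diagonal factor scales
  rows, whence its \<open>i\<close>-th entry is \<open>d (\<sigma> i)\<close>.\<close>

lemma monomial_mat_factorization:
  obtains D \<sigma> where "D \<in> carrier_mat n n" "diagonal_mat D" "\<forall>i<n. 0 < D $$ (i, i)"
    "\<sigma> permutes {..<n}" "D * perm_matrix n \<sigma> = W"
proof -
  \<comment> \<open>\<open>permutes\<close> demands the identity outside the index range.\<close>
  define \<sigma> where "\<sigma> i = (if i < n then inv_into {..<n} \<pi> i else i)" for i
  define D where "D = mat n n (\<lambda>(i, j). if i = j then d (\<sigma> i) else 0)"
  have inv: "bij_betw (inv_into {..<n} \<pi>) {..<n} {..<n}" by (rule bij_betw_inv_into[OF \<pi>])
  then have "bij_betw \<sigma> {..<n} {..<n}"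
    by (rule bij_betw_cong[THEN iffD1, rotated]) (simp add: \<sigma>_def)
  then have \<sigma>: "\<sigma> permutes {..<n}" by (rule bij_imp_permutes) (simp add: \<sigma>_def)
  have \<sigma>_less: "\<sigma> i < n" if "i < n" for i using permutes_in_image[OF \<sigma>, of i] that by simp
  have \<sigma>_iff: "j = \<sigma> i \<longleftrightarrow> i = \<pi> j" if "i < n" "j < n" for i j
    using that \<pi> by (auto simp: \<sigma>_def bij_betw_def f_inv_into_f inv_into_f_f)
  have D: "D \<in> carrier_mat n n" by (simp add: D_def)
  have P: "perm_matrix n \<sigma> \<in> carrier_mat n n" by (simp add: perm_matrix_def)
  have "D * perm_matrix n \<sigma> = W"
  proof (rule eq_matI)
    fix i j assume "i < dim_row W" "j < dim_col W"
    then have ij: "i < n" "j < n" by (simp_all add: monomial_mat_def)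
    have "(D * perm_matrix n \<sigma>) $$ (i, j) = (\<Sum>u<n. D $$ (i, u) * perm_matrix n \<sigma> $$ (u, j))"
      by (rule index_mult_mat_sum[OF D P ij])
    also have "\<dots> = D $$ (i, i) * perm_matrix n \<sigma> $$ (i, j)"
      using ij by (intro sum_singleton_support) (auto simp: D_def)
    also have "\<dots> = W $$ (i, j)"
      using ij \<sigma>_iff[OF ij] by (auto simp: D_def perm_matrix_def monomial_mat_def)
    finally show "(D * perm_matrix n \<sigma>) $$ (i, j) = W $$ (i, j)" .
  qed (simp_all add: D_def perm_matrix_def monomial_mat_def)
  moreover have "diagonal_mat D" by (simp add: diagonal_mat_def D_def)
  moreover have "\<forall>i<n. 0 < D $$ (i, i)" by (simp add: D_def d \<sigma>_less)
  ultimately show ?thesis using D \<sigma> by (intro that)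
qed

end

text \<open>One inclusion comes from this context and the other from its dual, applied to the matrix
  conjugated backwards.\<close>

lemma (in morita_context) fundamental_group_conj:
  fixes \<phi> :: "nat \<Rightarrow> ('a \<Rightarrow>\<^sub>L complex)" and \<psi> :: "nat \<Rightarrow> ('b \<Rightarrow>\<^sub>L complex)"
  defines "n \<equiv> trace_dim TYPE('a)"
  assumes \<phi>: "trace_indexing \<phi>" and \<psi>: "trace_indexing \<psi>"
  obtains \<pi> d where "bij_betw \<pi> {..<n} {..<n}" "\<forall>j<n. d j > 0"
    "fundamental_group \<psi> = (\<lambda>M. monomial_mat_inv n \<pi> d * M * monomial_mat n \<pi> d) ` fundamental_group \<phi>"
proof -
  interpret dual: morita_context "\<lambda>b x. ract x (star b)" "\<lambda>x a. lact (star a) x" rinner linner w m z l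
    by (rule dual)
  interpret trace_equivalence transfer dual_transfer by (rule trace_equivalence)
  have n: "trace_dim TYPE('b) = n" by (simp add: n_def trace_dim_eq)
  obtain \<pi> d where \<pi>: "bij_betw \<pi> {..<n} {..<n}" and d: "\<forall>j<n. d j > 0"
    and T: "\<And>j. j < n \<Longrightarrow> transfer (\<psi> j) = d j *\<^sub>R \<phi> (\<pi> j)"
    and tr: "\<And>j. j < n \<Longrightarrow> \<psi> j \<in> traces"
    unfolding n_def using trace_indexing_correspondence[OF \<phi> \<psi>] by blast
  let ?W = "monomial_mat n \<pi> d" and ?W' = "monomial_mat_inv n \<pi> d"
  note W = monomial_mat_carrier[of n \<pi> d] and conj = monomial_mat_conj[of \<pi> n d, OF \<pi> d]
    and inverse = monomial_mat_inv_mult[of \<pi> n d, OF \<pi> d] monomial_mat_mult[of \<pi> n d, OF \<pi> d]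
  define \<rho> where "\<rho> = inv_into {..<n} \<pi>"
  have \<rho>: "bij_betw \<rho> {..<n} {..<n}" unfolding \<rho>_def by (rule bij_betw_inv_into[OF \<pi>])
  have \<rho>_less: "\<rho> i < n" and \<pi>\<rho>: "\<pi> (\<rho> i) = i" if "i < n" for i
    using bij_betw_inv_into_right[OF \<pi>] \<rho> that by (auto simp: \<rho>_def bij_betw_def)
  have "?W' * M * ?W \<in> fundamental_group \<psi>" if M: "M \<in> fundamental_group \<phi>" for M
  proof (rule fundamental_group_transfer[OF M])
    have M: "M \<in> carrier_mat n n" using M by (simp add: fundamental_group_def n_def)
    show "?W' * M * ?W \<in> carrier_mat (trace_dim TYPE('a)) (trace_dim TYPE('a))"
      using M W by (simp add: n_def)
    show "(?W' * M * ?W) $$ (i, j) = d j / d i * M $$ (\<pi> i, \<pi> j)"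
      if "i < trace_dim TYPE('a)" "j < trace_dim TYPE('a)" for i j
      using conj[OF M] that by (simp add: n_def)
  qed (use \<pi> d T tr in \<open>simp_all add: n_def\<close>)
  moreover have "\<exists>M\<in>fundamental_group \<phi>. C = ?W' * M * ?W" if C: "C \<in> fundamental_group \<psi>" for C
  proof
    have Cc: "C \<in> carrier_mat n n" using C by (simp add: fundamental_group_def n)
    define M where "M = ?W * C * ?W'"
    have M: "M \<in> carrier_mat n n" using W Cc by (simp add: M_def)
    have "?W' * M * ?W = (?W' * ?W) * C * (?W' * ?W)"
      using W Cc M by (simp add: M_def assoc_mult_mat[of _ n n _ n _ n])
    then show CM: "C = ?W' * M * ?W" using Cc by (simp add: inverse)
    have entry: "M $$ (i, j) = d (\<rho> i) / d (\<rho> j) * C $$ (\<rho> i, \<rho> j)" if "i < n" "j < n" for i j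
      unfolding CM conj[OF M \<rho>_less[OF that(1)] \<rho>_less[OF that(2)]]
      using that d[rule_format, OF \<rho>_less[OF that(1)]] d[rule_format, OF \<rho>_less[OF that(2)]] by (simp add: \<pi>\<rho>)
    show "M \<in> fundamental_group \<phi>"
    \<comment> \<open>The dual transfer sends \<open>\<phi> i\<close> to a multiple of
      \<open>\<psi> (\<rho> i)\<close> by the factor \<open>1 / d (\<rho> i)\<close>; the quotient
      of two such weights matches \<open>entry\<close>.\<close>
    proof (rule dual.fundamental_group_transfer[OF C, where \<pi> = \<rho> and d = "\<lambda>i. 1 / d (\<rho> i)", unfolded n])
      fix i assume i: "i < n"
      show "\<phi> i \<in> traces"
        using \<phi> i by (auto simp: trace_indexing_def bij_betw_def n_def positive_traces1_def
            dest!: extreme_traces_positive)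
      have "\<phi> i = (1 / d (\<rho> i)) *\<^sub>R transfer (\<psi> (\<rho> i))"
        using T[OF \<rho>_less[OF i]] d[rule_format, OF \<rho>_less[OF i]] by (simp add: \<pi>\<rho> i)
      then show "dual_transfer (\<phi> i) = (1 / d (\<rho> i)) *\<^sub>R \<psi> (\<rho> i)"
        by (simp add: S_scaleR S_T tr \<rho>_less i)
    qed (use \<rho> M d \<rho>_less entry in simp_all)
  qed
  ultimately have "fundamental_group \<psi> = (\<lambda>M. ?W' * M * ?W) ` fundamental_group \<phi>" by blast
  then show ?thesis using \<pi> d by (intro that)
qed


section \<open>The two invariants\<close>

lemma (in morita_context) weightedly_isomorphic: "weightedly_isomorphic TYPE('a) TYPE('b)"
  unfolding weightedly_isomorphic_def Let_def
proof (intro conjI allI impI)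
  show "trace_dim TYPE('a) = trace_dim TYPE('b)"
    using trace_equivalence.trace_dim_eq[OF trace_equivalence] by simp
next
  fix \<phi> :: "nat \<Rightarrow> ('a \<Rightarrow>\<^sub>L complex)" and \<psi> :: "nat \<Rightarrow> ('b \<Rightarrow>\<^sub>L complex)"
  assume "trace_indexing \<phi>" "trace_indexing \<psi>"
  define n where "n = trace_dim TYPE('a)"
  obtain \<pi> d where \<pi>: "bij_betw \<pi> {..<n} {..<n}" and d: "\<forall>j<n. d j > 0"
    and F: "fundamental_group \<psi>
      = (\<lambda>M. monomial_mat_inv n \<pi> d * M * monomial_mat n \<pi> d) ` fundamental_group \<phi>"
    unfolding n_def by (rule fundamental_group_conj[OF \<open>trace_indexing \<phi>\<close> \<open>trace_indexing \<psi>\<close>]) blast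
  obtain D \<sigma> where D: "D \<in> carrier_mat n n" "diagonal_mat D" "\<forall>i<n. 0 < D $$ (i, i)"
    "\<sigma> permutes {..<n}" "D * perm_matrix n \<sigma> = monomial_mat n \<pi> d"
    using monomial_mat_factorization[of \<pi> n d, OF \<pi> d] by blast
  have "inverts_mat (monomial_mat_inv n \<pi> d) (D * perm_matrix n \<sigma>)"
    "inverts_mat (D * perm_matrix n \<sigma>) (monomial_mat_inv n \<pi> d)"
    unfolding D(5) inverts_mat_def
    using monomial_mat_inv_mult[of \<pi> n d, OF \<pi> d] monomial_mat_mult[of \<pi> n d, OF \<pi> d] monomial_mat_carrier[of n \<pi> d]
    by auto
  then show "\<exists>D \<sigma> W'. D \<in> carrier_mat (trace_dim TYPE('a)) (trace_dim TYPE('a)) \<and> diagonal_mat D \<and>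
      (\<forall>i<trace_dim TYPE('a). 0 < D $$ (i, i)) \<and> \<sigma> permutes {..<trace_dim TYPE('a)} \<and>
      W' \<in> carrier_mat (trace_dim TYPE('a)) (trace_dim TYPE('a)) \<and>
      inverts_mat W' (D * perm_matrix (trace_dim TYPE('a)) \<sigma>) \<and>
      inverts_mat (D * perm_matrix (trace_dim TYPE('a)) \<sigma>) W' \<and>
      fundamental_group \<psi> = (\<lambda>M. W' * M * (D * perm_matrix (trace_dim TYPE('a)) \<sigma>)) ` fundamental_group \<phi>"
    unfolding n_def [symmetric] using D(1-4) F monomial_mat_carrier(2)[of n \<pi> d]
    by (intro exI[of _ D] exI[of _ \<sigma>] exI[of _ "monomial_mat_inv n \<pi> d"]) (simp add: D(5))
qed

text \<open>Conjugation leaves determinants unchanged. As the set ranges over all indexings, an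
  indexing on one side must also produce one on the other, and \<open>normalize\<close> does this in
  both directions.\<close>

lemma (in morita_context) det_fundamental_group_eq:
  "det_fundamental_group TYPE('a) = det_fundamental_group TYPE('b)"
proof -
  interpret T: trace_equivalence transfer dual_transfer by (rule trace_equivalence)
  interpret S: trace_equivalence dual_transfer transfer by (rule T.swap)
  have same_det: "(\<lambda>B. \<bar>Determinant.det B\<bar>) ` fundamental_group \<psi> = (\<lambda>B. \<bar>Determinant.det B\<bar>) ` fundamental_group \<phi>"
    if ix: "trace_indexing \<phi>" "trace_indexing \<psi>"
    for \<phi> :: "nat \<Rightarrow> ('a \<Rightarrow>\<^sub>L complex)" and \<psi> :: "nat \<Rightarrow> ('b \<Rightarrow>\<^sub>L complex)"
  proof -
    obtain \<pi> d where \<pi>: "bij_betw \<pi> {..<trace_dim TYPE('a)} {..<trace_dim TYPE('a)}"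
      and d: "\<forall>j<trace_dim TYPE('a). d j > 0"
      and F: "fundamental_group \<psi> = (\<lambda>M. monomial_mat_inv (trace_dim TYPE('a)) \<pi> d * M
        * monomial_mat (trace_dim TYPE('a)) \<pi> d) ` fundamental_group \<phi>"
      by (rule fundamental_group_conj[OF ix]) blast
    show ?thesis
      unfolding F image_image
      by (intro image_cong refl) (simp add: fundamental_group_def det_monomial_mat_conj[OF \<pi> d])
  qed
  show ?thesis
  proof (intro equalityI subsetI)
    fix x assume "x \<in> det_fundamental_group TYPE('a)"
    then obtain B and \<phi> :: "nat \<Rightarrow> ('a \<Rightarrow>\<^sub>L complex)" where
      B: "x = \<bar>Determinant.det B\<bar>" "trace_indexing \<phi>" "B \<in> fundamental_group \<phi>"
      by (auto simp: det_fundamental_group_def)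
    from S.trace_indexing_normalize[OF B(2)] same_det[OF B(2)] B
    show "x \<in> det_fundamental_group TYPE('b)"
      unfolding det_fundamental_group_def by blast
  next
    fix x assume "x \<in> det_fundamental_group TYPE('b)"
    then obtain B and \<psi> :: "nat \<Rightarrow> ('b \<Rightarrow>\<^sub>L complex)" where
      B: "x = \<bar>Determinant.det B\<bar>" "trace_indexing \<psi>" "B \<in> fundamental_group \<psi>"
      by (auto simp: det_fundamental_group_def)
    from T.trace_indexing_normalize[OF B(2)] same_det[OF _ B(2)] B
    show "x \<in> det_fundamental_group TYPE('a)"
      unfolding det_fundamental_group_def by blast
  qed
qed

theorem proposition3p12:
  assumes "finite_dim_traces TYPE('a::cstar_algebra)"
    and "finite_dim_traces TYPE('b::cstar_algebra)"
    and "morita_equivalent_via TYPE('x::complex_vector) TYPE('a) TYPE('b)"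
  shows "weightedly_isomorphic TYPE('a) TYPE('b) \<and>
         det_fundamental_group TYPE('a) = det_fundamental_group TYPE('b)"
proof -
  obtain lact :: "'a \<Rightarrow> 'x \<Rightarrow> 'x" and ract :: "'x \<Rightarrow> 'b \<Rightarrow> 'x"
    and linner :: "'x \<Rightarrow> 'x \<Rightarrow> 'a" and rinner :: "'x \<Rightarrow> 'x \<Rightarrow> 'b"
    where "imprimitivity_bimodule lact ract linner rinner"
    using assms(3) by (auto simp: morita_equivalent_via_def)
  then obtain z l w m where "morita_context lact ract linner rinner z l w m"
    by (rule imprimitivity_bimodule_morita_context)
  then show ?thesis
    using morita_context.weightedly_isomorphic morita_context.det_fundamental_group_eq by blast
qed

end
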